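(* Consider a branching random walk with offspring law $\{p_k\}_{k\ge 0}$ and step size $X$, with offspring numbers and displacements independent, and let $M_n$ be its maximal position at generation $n$. Assume that (i) $m:=\sum_{k\ge 0}kp_k>1$ and $\sum_{k\ge 0}k^{1+\xi}p_k<\infty$ for some $\xi>0$; (ii) $\mathbb{E}[X]=0$ and, for some $K\in(0,\infty]$, $\psi(t):=\mathbb{E}[e^{tX}]<\infty$ for all $t\in(-K,K)$; (iii) $b:=\min\{k\ge 0:p_k>0\}\ge 2$; (iv) $\operatorname{ess\,inf}X=-L$ for some $0<L<\infty$. Then for every $x\in(-L,x^* )$, $$\lim_{n\to\infty}\frac1n\log\bigl[-\log\mathbb{P}(M_n\le xn)\bigr]=\frac{x^*-x}{x^*+L}\log b .$$ If moreover $\mathbb{P}(X=-L)>0$, then this also holds for $x=-L$.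
   Context: Branching random walk: $\mathcal{T}$ is a Galton–Watson tree with root $\rho$ and offspring distribution $\{p_k\}_{k\ge0}$. Given $\mathcal{T}$, the displacements $\{X_v: v\in\mathcal{T}\setminus\{\rho\}\}$ are i.i.d. copies of a real random variable $X$. The position of $v\in\mathcal{T}$ is $S_v:=\sum_{\rho\prec u\preceq v}X_u$ (sum over the vertices $u\neq\rho$ on the ancestral line of $v$, including $v$), with $S_\rho:=0$. With $|v|$ the generation of $v$, $M_n:=\sup_{|v|=n}S_v$. Rate function: $I(x):=\sup_{t\in\mathbb{R}}\{tx-\log\psi(t)\}$ for $x\in\mathbb{R}$, where $\psi(t)=\mathbb{E}[e^{tX}]\in(0,\infty]$. Speed: $x^*:=\sup\{x\ge0: I(x)\le\log m\}\in(0,\infty)$. *)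

theory Defs
  imports "HOL-Probability.Probability" "HOL-Library.Sublist"
begin

text \<open>
  Vertices are Ulam--Harris words \<open>v :: nat list\<close>: the root is \<open>[]\<close>, the children of \<open>v\<close> are
  \<open>v @ [0], v @ [1], \<dots>\<close>, the generation of \<open>v\<close> is \<open>length v\<close>, and \<open>u \<preceq> v\<close> is \<open>prefix u v\<close>.
  In the deterministic notions below, \<open>c v\<close> is the number of children of \<open>v\<close> and \<open>y v\<close> its displacement.
\<close>

inductive_set gw_tree :: "(nat list \<Rightarrow> nat) \<Rightarrow> nat list set" for c :: "nat list \<Rightarrow> nat" where
  root: "[] \<in> gw_tree c"
| child: "v \<in> gw_tree c \<Longrightarrow> i < c v \<Longrightarrow> v @ [i] \<in> gw_tree c"

definition brw_position :: "(nat list \<Rightarrow> real) \<Rightarrow> nat list \<Rightarrow> real" where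
  "brw_position y v = (\<Sum>u | strict_prefix [] u \<and> prefix u v. y u)"

text \<open>Extended-real valued, so that the supremum over an empty generation is \<open>-\<infinity>\<close>.\<close>

definition brw_max :: "(nat list \<Rightarrow> nat) \<Rightarrow> (nat list \<Rightarrow> real) \<Rightarrow> nat \<Rightarrow> ereal" where
  "brw_max c y n = (SUP v \<in> {v \<in> gw_tree c. length v = n}. ereal (brw_position y v))"

text \<open>
  Offspring numbers and displacements are attached to all words (the root has no displacement);
  only those of words in the random tree enter \<open>brw_max\<close>. The last assumption is
  the independence of the offspring family from the displacement family.
\<close>

locale branching_random_walk = prob_space M
  for M :: "'w measure" +
  fixes p :: "nat pmf" and step :: "real measure"
    and N :: "nat list \<Rightarrow> 'w \<Rightarrow> nat" and X :: "nat list \<Rightarrow> 'w \<Rightarrow> real"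
  assumes offspring_indep: "indep_vars (\<lambda>_. count_space UNIV) N UNIV"
    and offspring_law: "\<And>v. distr M (count_space UNIV) (N v) = measure_pmf p"
    and displacement_indep: "indep_vars (\<lambda>_. borel) X {v. v \<noteq> []}"
    and displacement_law: "\<And>v. v \<noteq> [] \<Longrightarrow> distr M borel (X v) = step"
    and offspring_displacement_indep:
      "indep_var (PiM UNIV (\<lambda>_. count_space UNIV)) (\<lambda>\<omega>. \<lambda>v\<in>UNIV. N v \<omega>)
                 (PiM {v. v \<noteq> []} (\<lambda>_. borel)) (\<lambda>\<omega>. \<lambda>v\<in>{v. v \<noteq> []}. X v \<omega>)"

definition offspring_mean :: "nat pmf \<Rightarrow> real" where
  "offspring_mean p = (\<Sum>k. real k * pmf p k)"

definition min_offspring :: "nat pmf \<Rightarrow> nat" where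
  "min_offspring p = (LEAST k. pmf p k > 0)"

definition mgf :: "real measure \<Rightarrow> real \<Rightarrow> ennreal" where
  "mgf step t = (\<integral>\<^sup>+ x. ennreal (exp (t * x)) \<partial>step)"

definition ln_ennreal :: "ennreal \<Rightarrow> ereal" where
  "ln_ennreal a = (if a = 0 then -\<infinity> else if a = \<infinity> then \<infinity> else ereal (ln (enn2real a)))"

definition rate_function :: "real measure \<Rightarrow> real \<Rightarrow> ereal" where
  "rate_function step x = (SUP t. ereal (t * x) - ln_ennreal (mgf step t))"

definition speed :: "nat pmf \<Rightarrow> real measure \<Rightarrow> real" where
  "speed p step = Sup {x. 0 \<le> x \<and> rate_function step x \<le> ereal (ln (offspring_mean p))}"

definition essinf :: "'a measure \<Rightarrow> ('a \<Rightarrow> real) \<Rightarrow> ereal" where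
  "essinf M f = - esssup M (\<lambda>x. - ereal (f x))"

end

theory Submission
  imports Defs
begin

text \<open>
  Splitting at the first generation, \<open>F\<^sub>n y = P(M\<^sub>n \<le> y)\<close> satisfies \<open>F\<^sub>n\<^sub>+\<^sub>1 y = g (\<integral> F\<^sub>n (y - x) d\<mu>(x))\<close>,
  where \<open>g\<close> is the generating function of \<open>p\<close> and \<open>\<mu>\<close> the step law; everything else is about this
  recursion. Since \<open>p\<^sub>b s\<^sup>b \<le> g s \<le> s\<^sup>b\<close> and \<open>X \<ge> -L\<close>, iterating it \<open>j\<close> times gives
  \<open>F\<^sub>k (y + j l)\<close> to the power \<open>b\<^sup>j\<close> as a lower bound of \<open>F\<^sub>k\<^sub>+\<^sub>j y\<close> for \<open>l < L\<close> (up to a constant inside the power),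
  and as an upper bound for \<open>l = L\<close>. With \<open>y = xn\<close>, \<open>k + j = n\<close> and \<open>j \<approx> \<alpha>n\<close>, the base of the power is of order
  one exactly at the threshold \<open>x + \<alpha>L = x\<^sup>* (1 - \<alpha>)\<close>, provided that \<open>F\<^sub>k (ak)\<close> stays away from \<open>0\<close> for
  \<open>a > x\<^sup>*\<close> (first moment) and away from \<open>1\<close> for \<open>a < x\<^sup>*\<close>. For the latter, \<open>1 - g (1 - u) \<ge> m' min u u\<^sub>0\<close> for any \<open>m' < m\<close>,
  so that a lower bound of \<open>1 - F\<^sub>n\<close> by a step function survives \<open>l\<close> generations while its front moves by \<open>al\<close>, as soon as
  \<open>m'\<^sup>l P(S\<^sub>l \<ge> al) \<ge> 1\<close>; such an \<open>l\<close> exists by the lower bound in Cramer's theorem.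
\<close>

subsection \<open>Recursion for the law of the maximum\<close>

text \<open>The exponent has a picture: to keep the maximum below xn, the first j generations form a
  b-ary tree all of whose lines descend at slope nearly L, and the remaining k generations behave
  typically, at slope near the speed. This costs a constant factor for each of about
  \<open>b ^ j\<close> vertices, hence the double logarithm. Two obstacles shape the lower bound on
  \<open>1 - F\<^sub>n\<close>. As \<psi> may be infinite away from 0, the infimum over t of
  exp(-ta)\<psi>(t) need not sit at a stationary point, and no exponential tilt need have mean a.
  Cutting the step to a window around a makes the function finite for all t; it has an interior
  minimum because X charges both sides of a, and a large window loses arbitrarily little of the
  infimum. Moreover, the speed is a mere supremum of points with I \<le> log m, whereas Cramer's
  bound has to be compensated by some m' < m. The strict gain comes from scaling: if tz \<le> log m
  + log \<psi>(t) for all t, then multiplying by \<theta> < 1 and using log \<psi> \<ge> 0 gives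
  I(\<theta>z) \<le> \<theta> log m.\<close>

lemma snoc_in_gw_tree: "v @ [i] \<in> gw_tree c \<longleftrightarrow> v \<in> gw_tree c \<and> i < c v"
  by (auto elim: gw_tree.cases intro: gw_tree.intros)

text \<open>\<open>gw_tree\<close> grows words at their end, while a split at the first generation
  removes their first letter; induction on the end of the word mediates between the two.\<close>

lemma Cons_in_gw_tree:
  "i # w \<in> gw_tree c \<longleftrightarrow> i < c [] \<and> w \<in> gw_tree (\<lambda>u. c (i # u))"
proof (induction w rule: rev_induct)
  case Nil
  show ?case
    using snoc_in_gw_tree[of "[]" i c] by (simp add: gw_tree.root)
next
  case (snoc j w)
  show ?case
    using snoc_in_gw_tree[of "i # w" j c] snoc by (simp add: snoc_in_gw_tree)
qed

lemma finite_ancestors: "finite {u. strict_prefix [] u \<and> prefix u v}"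
  by (rule finite_subset[OF _ finite_set[of "prefixes v"]]) auto

lemma brw_position_Nil [simp]: "brw_position y [] = 0"
  by (auto simp: brw_position_def strict_prefix_def intro!: sum.neutral)

lemma brw_position_Cons:
  "brw_position y (i # w) = y [i] + brw_position (\<lambda>u. y (i # u)) w"
proof -
  have *: "{u. strict_prefix [] u \<and> prefix u (i # w)} =
      insert [i] ((#) i ` {u. strict_prefix [] u \<and> prefix u w})"
  proof (intro set_eqI iffI)
    fix u assume "u \<in> {u. strict_prefix [] u \<and> prefix u (i # w)}"
    then show "u \<in> insert [i] ((#) i ` {u. strict_prefix [] u \<and> prefix u w})"
      by (cases u; cases "tl u") (auto simp: strict_prefix_def)
  qed (auto simp: strict_prefix_def)
  show ?thesis
    unfolding brw_position_def *
    by (subst sum.insert) (auto simp: finite_ancestors sum.reindex)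
qed

lemma brw_max_0: "brw_max c y 0 = 0"
proof -
  have "{v \<in> gw_tree c. length v = 0} = {[]}"
    by (auto intro: gw_tree.root)
  then show ?thesis
    by (simp add: brw_max_def zero_ereal_def)
qed

text \<open>The form with \<le>, instead of an equation between maxima, is the one the law needs,
  and it covers a childless root, whose later generations have maximum -\<infinity>, without a
  special case.\<close>

lemma brw_max_Suc_le_iff:
  "brw_max c y (Suc n) \<le> ereal s \<longleftrightarrow>
    (\<forall>i<c []. brw_max (\<lambda>u. c (i # u)) (\<lambda>u. y (i # u)) n \<le> ereal (s - y [i]))"
proof -
  have "brw_max c y (Suc n) \<le> ereal s \<longleftrightarrow>
      (\<forall>i w. i # w \<in> gw_tree c \<and> length w = n \<longrightarrow> brw_position y (i # w) \<le> s)"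
    by (auto simp: brw_max_def SUP_le_iff length_Suc_conv)
  also have "\<dots> \<longleftrightarrow> (\<forall>i<c []. \<forall>w. w \<in> gw_tree (\<lambda>u. c (i # u)) \<and> length w = n \<longrightarrow>
      brw_position (\<lambda>u. y (i # u)) w \<le> s - y [i])"
    by (auto simp: Cons_in_gw_tree brw_position_Cons algebra_simps)
  also have "\<dots> \<longleftrightarrow> (\<forall>i<c []. brw_max (\<lambda>u. c (i # u)) (\<lambda>u. y (i # u)) n \<le> ereal (s - y [i]))"
    by (auto simp: brw_max_def SUP_le_iff)
  finally show ?thesis .
qed

lemma measurable_mem_gw_tree:
  assumes [measurable]: "\<And>v. (\<lambda>\<omega>. c \<omega> v) \<in> measurable M (count_space UNIV)"
  shows "Measurable.pred M (\<lambda>\<omega>. v \<in> gw_tree (c \<omega>))"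
proof (induction v rule: rev_induct)
  case (snoc i v)
  then have [measurable]: "Measurable.pred M (\<lambda>\<omega>. v \<in> gw_tree (c \<omega>))" .
  show ?case
    unfolding snoc_in_gw_tree by measurable
qed (simp add: gw_tree.root)

lemma borel_measurable_brw_max:
  assumes c: "\<And>v. (\<lambda>\<omega>. c \<omega> v) \<in> measurable M (count_space UNIV)"
    and y: "\<And>v. v \<noteq> [] \<Longrightarrow> (\<lambda>\<omega>. y \<omega> v) \<in> borel_measurable M"
  shows "(\<lambda>\<omega>. brw_max (c \<omega>) (y \<omega>) n) \<in> borel_measurable M"
proof -
  \<comment> \<open>The index set of the supremum is random; it is replaced by all words of length
    \<open>n\<close>, a countable set, with the value -\<infinity> off the tree.\<close>
  have eq: "brw_max (c \<omega>) (y \<omega>) n =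
      (SUP v\<in>{v. length v = n}. if v \<in> gw_tree (c \<omega>) then ereal (brw_position (y \<omega>) v) else -\<infinity>)" for \<omega>
  proof (unfold brw_max_def, intro antisym SUP_least)
    fix v assume "v \<in> {v \<in> gw_tree (c \<omega>). length v = n}"
    then show "ereal (brw_position (y \<omega>) v) \<le> (SUP v\<in>{v. length v = n}.
        if v \<in> gw_tree (c \<omega>) then ereal (brw_position (y \<omega>) v) else -\<infinity>)"
      by (intro SUP_upper2[of v]) simp_all
  qed (auto intro: SUP_upper)
  have [measurable]: "Measurable.pred M (\<lambda>\<omega>. v \<in> gw_tree (c \<omega>))" for v
    by (rule measurable_mem_gw_tree[OF c])
  have [measurable]: "(\<lambda>\<omega>. brw_position (y \<omega>) v) \<in> borel_measurable M" for v
    unfolding brw_position_def by (intro borel_measurable_sum y) auto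
  show ?thesis
    unfolding eq by (intro borel_measurable_SUP) auto
qed

section \<open>Independence and the law of the maximum\<close>

lemma (in prob_space) indep_vars_reindex:
  assumes "indep_vars M' X I" "inj_on f J" "f ` J \<subseteq> I"
  shows "indep_vars (\<lambda>j. M' (f j)) (\<lambda>j. X (f j)) J"
proof -
  have "indep_vars (\<lambda>j. PiM {f j} M') (\<lambda>j \<omega>. restrict (\<lambda>i. X i \<omega>) {f j}) J"
    using assms by (intro indep_vars_restrict[where I = I])
      (auto simp: disjoint_family_on_def inj_on_def)
  then have "indep_vars (\<lambda>j. M' (f j)) (\<lambda>j \<omega>. restrict (\<lambda>i. X i \<omega>) {f j} (f j)) J"
    by (rule indep_vars_compose2[where Y = "\<lambda>j g. g (f j)"]) (auto intro: measurable_component_singleton)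
  then show ?thesis
    by simp
qed

text \<open>Taking the recursion as the definition detaches it from the tree: once
  \<open>prob_joint_brw_le\<close> has identified it with the law of the maximum, all estimates are
  analytic.\<close>

primrec brw_cdf :: "nat pmf \<Rightarrow> real measure \<Rightarrow> nat \<Rightarrow> real \<Rightarrow> real" where
  "brw_cdf p \<mu> 0 y = (if 0 \<le> y then 1 else 0)"
| "brw_cdf p \<mu> (Suc n) y =
    measure_pmf.expectation p (\<lambda>k. (\<integral>x. brw_cdf p \<mu> n (y - x) \<partial>\<mu>) ^ k)"

text \<open>
  \<open>Y (False, v)\<close> is the number of children of \<open>v\<close> and \<open>Y (True, v)\<close> its displacement, so that the
  offspring numbers and the displacements form one independent family of real variables.
\<close>

definition joint_brw :: "(bool \<times> nat list \<Rightarrow> real) \<Rightarrow> nat \<Rightarrow> ereal" where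
  "joint_brw y n = brw_max (\<lambda>v. nat \<lfloor>y (False, v)\<rfloor>) (\<lambda>v. y (True, v)) n"

text \<open>The index \<open>(True, [])\<close> would be a displacement of the root, which no
  position reads. The congruence allows \<open>restrict\<close> to leave an arbitrary value
  there.\<close>

lemma joint_brw_cong:
  assumes "\<And>j. j \<noteq> (True, []) \<Longrightarrow> y j = y' j"
  shows "joint_brw y n = joint_brw y' n"
proof -
  have "brw_position (\<lambda>v. y (True, v)) v = brw_position (\<lambda>v. y' (True, v)) v" for v
    unfolding brw_position_def by (intro sum.cong) (auto intro!: assms)
  then show ?thesis
    by (simp add: joint_brw_def brw_max_def assms)
qed

lemma joint_brw_Suc_le_iff:
  assumes "y (False, []) = real k"
  shows "joint_brw y (Suc n) \<le> ereal s \<longleftrightarrow>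
    (\<forall>i<k. joint_brw (\<lambda>(a, u). y (a, i # u)) n \<le> ereal (s - y (True, [i])))"
  by (simp add: joint_brw_def brw_max_Suc_le_iff assms)

lemma borel_measurable_joint_brw:
  assumes "\<And>j. j \<noteq> (True, []) \<Longrightarrow> (\<lambda>\<omega>. y \<omega> j) \<in> borel_measurable M"
  shows "(\<lambda>\<omega>. joint_brw (y \<omega>) n) \<in> borel_measurable M"
proof -
  have [measurable]: "(\<lambda>\<omega>. y \<omega> (False, v)) \<in> borel_measurable M" for v
    by (rule assms) simp
  show ?thesis
    unfolding joint_brw_def by (intro borel_measurable_brw_max assms) (auto, measurable)
qed

lemma sums_expectation_nat_pmf:
  assumes "integrable (measure_pmf p) f"
  shows "(\<lambda>k::nat. pmf p k * f k) sums measure_pmf.expectation p f"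
proof -
  have "integrable (count_space UNIV) (\<lambda>k. pmf p k * f k)"
    using assms unfolding measure_pmf_eq_density
    by (subst (asm) integrable_density) auto
  then have "(\<lambda>k. pmf p k * f k) sums (\<integral>k. pmf p k * f k \<partial>count_space UNIV)"
    by (rule sums_integral_count_space_nat)
  also have "(\<integral>k. pmf p k * f k \<partial>count_space UNIV) = measure_pmf.expectation p f"
    unfolding measure_pmf_eq_density by (subst integral_density) auto
  finally show ?thesis .
qed

lemma integrable_pmf_bounded:
  fixes f :: "'a \<Rightarrow> real"
  assumes "\<And>k. \<bar>f k\<bar> \<le> B"
  shows "integrable (measure_pmf p) f"
  using assms by (intro measure_pmf.integrable_const_bound[where B = B]) auto

context real_distribution
begin

text \<open>The claims have to go through the induction together: monotonicity yields measurability,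
  and with the bounds this yields the integrability on which the next step of the recursion
  depends.\<close>

lemma brw_cdf_bounds_mono:
  "0 \<le> brw_cdf p M n y \<and> brw_cdf p M n y \<le> 1 \<and> (y \<le> z \<longrightarrow> brw_cdf p M n y \<le> brw_cdf p M n z)"
proof (induction n arbitrary: y z)
  case (Suc n)
  have mono: "mono (brw_cdf p M n)"
    using Suc by (simp add: mono_def)
  have meas: "brw_cdf p M n \<in> borel_measurable borel"
    using mono by (rule borel_measurable_mono)
  have int: "integrable M (\<lambda>x. brw_cdf p M n (y - x))" for y
    using meas Suc by (intro integrable_const_bound[where B = 1]) (auto simp: measurable_compose)
  define g where "g y = (\<integral>x. brw_cdf p M n (y - x) \<partial>M)" for y
  have g: "0 \<le> g y" "g y \<le> 1" for y
    using Suc integral_le_const[OF int, of y 1] unfolding g_def by auto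
  have "g y \<le> g z" if "y \<le> z"
    unfolding g_def using that Suc by (intro integral_mono int) auto
  then have "g y ^ k \<le> g z ^ k" if "y \<le> z" for k
    using that g by (intro power_mono) auto
  moreover have int': "integrable (measure_pmf p) (\<lambda>k. g y ^ k)" for y
    using g by (intro integrable_pmf_bounded[where B = 1]) (auto simp: power_le_one)
  moreover have "measure_pmf.expectation p (\<lambda>k. g y ^ k) \<le> 1"
    using g by (intro measure_pmf.integral_le_const int') (auto simp: power_le_one)
  moreover have "0 \<le> measure_pmf.expectation p (\<lambda>k. g y ^ k)"
    using g by (intro integral_nonneg_AE) auto
  ultimately have "0 \<le> measure_pmf.expectation p (\<lambda>k. g y ^ k) \<and>
      measure_pmf.expectation p (\<lambda>k. g y ^ k) \<le> 1 \<and>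
      (y \<le> z \<longrightarrow> measure_pmf.expectation p (\<lambda>k. g y ^ k) \<le> measure_pmf.expectation p (\<lambda>k. g z ^ k))"
    by (auto intro: integral_mono)
  then show ?case
    unfolding brw_cdf.simps g_def .
qed simp

lemma brw_cdf_nonneg: "0 \<le> brw_cdf p M n y"
  and brw_cdf_le_1: "brw_cdf p M n y \<le> 1"
  and brw_cdf_mono: "y \<le> z \<Longrightarrow> brw_cdf p M n y \<le> brw_cdf p M n z"
  using brw_cdf_bounds_mono[of p n y z] by simp_all

lemma borel_measurable_brw_cdf [measurable]: "brw_cdf p M n \<in> borel_measurable borel"
  by (intro borel_measurable_mono monoI brw_cdf_mono)

lemma integrable_brw_cdf: "integrable M (\<lambda>x. brw_cdf p M n (y - x))"
  by (intro integrable_const_bound[where B = 1]) (auto simp: brw_cdf_nonneg brw_cdf_le_1)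

end

text \<open>The family \<open>Y\<close> is arbitrary because the induction hypothesis is applied to
  the reindexed family of each child's subtree. Independence enters twice: between a child's
  displacement and its subtree, and between the offspring number of the root and the different
  children.\<close>

lemma (in prob_space) prob_joint_brw_le:
  fixes Y :: "bool \<times> nat list \<Rightarrow> 'a \<Rightarrow> real"
  assumes "indep_vars (\<lambda>_. borel) Y (UNIV - {(True, [])})"
    and "\<And>v. distr M borel (Y (False, v)) = distr (measure_pmf p) borel real"
    and "\<And>v. v \<noteq> [] \<Longrightarrow> distr M borel (Y (True, v)) = \<mu>"
  shows "prob {\<omega> \<in> space M. joint_brw (\<lambda>j. Y j \<omega>) n \<le> ereal s} = brw_cdf p \<mu> n s"
  using assms
proof (induction n arbitrary: Y s)
  case 0
  then show ?case
    by (auto simp: joint_brw_def brw_max_0 prob_space)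
next
  case (Suc n)
  define I where "I = (UNIV :: (bool \<times> nat list) set) - {(True, [])}"
  have indep: "indep_vars (\<lambda>_. borel) Y I"
    using Suc.prems unfolding I_def by blast
  have rv [measurable]: "random_variable borel (Y j)" if "j \<in> I" for j
    using indep that by (auto simp: indep_vars_def)
  have \<mu>: "\<mu> = distr M borel (Y (True, [0]))"
    using Suc.prems(3)[of "[0]"] by simp
  have "random_variable borel (Y (True, [0]))"
    by (rule rv) (simp add: I_def)
  then have "prob_space \<mu>"
    unfolding \<mu> by (rule prob_space_distr)
  moreover have sets_\<mu>: "sets \<mu> = sets borel"
    by (simp add: \<mu>)
  moreover have "space \<mu> = UNIV"
    by (simp add: \<mu>)
  ultimately interpret \<mu>: real_distribution \<mu>
    by (simp add: real_distribution_def real_distribution_axioms_def)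
  define Z where "Z i = (\<lambda>(a, u). Y (a, i # u))" for i :: nat
  define A where "A i = {\<omega> \<in> space M. joint_brw (\<lambda>j. Z i j \<omega>) n \<le> ereal (s - Y (True, [i]) \<omega>)}" for i
  have Z: "indep_vars (\<lambda>_. borel) (Z i) I" for i
  proof -
    have "indep_vars (\<lambda>_. borel) (\<lambda>j. Y (fst j, i # snd j)) I"
      by (rule indep_vars_reindex[OF indep]) (auto simp: I_def inj_on_def prod_eq_iff)
    then show ?thesis
      by (simp add: Z_def case_prod_unfold)
  qed
  have Z_le: "prob {\<omega> \<in> space M. joint_brw (\<lambda>j. Z i j \<omega>) n \<le> ereal r} = brw_cdf p \<mu> n r" for i r
    using Z[of i] Suc.prems(2,3) by (intro Suc.IH) (auto simp: Z_def I_def)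
  have A: "prob (A i) = (\<integral>x. brw_cdf p \<mu> n (s - x) \<partial>\<mu>)" for i
  proof -
    \<comment> \<open>The subtree of child \<open>i\<close> without the child's own displacement, so
      that the latter can be integrated out by Fubini.\<close>
    define D where "D = {(a, i # u) |a u. True} - {(True, [i])}"
    have "indep_var (PiM {(True, [i])} (\<lambda>_. borel)) (\<lambda>\<omega>. restrict (\<lambda>j. Y j \<omega>) {(True, [i])})
        (PiM D (\<lambda>_. borel)) (\<lambda>\<omega>. restrict (\<lambda>j. Y j \<omega>) D)"
      by (rule indep_var_restrict[OF indep]) (auto simp: D_def I_def)
    then have "indep_var borel ((\<lambda>g. ereal (g (True, [i]))) \<circ> (\<lambda>\<omega>. restrict (\<lambda>j. Y j \<omega>) {(True, [i])}))
        borel ((\<lambda>g. joint_brw (\<lambda>(a, u). g (a, i # u)) n) \<circ> (\<lambda>\<omega>. restrict (\<lambda>j. Y j \<omega>) D))"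
      by (rule indep_var_compose)
        (auto intro!: borel_measurable_joint_brw measurable_component_singleton borel_measurable_ereal simp: D_def)
    also have "(\<lambda>g. joint_brw (\<lambda>(a, u). g (a, i # u)) n) \<circ> (\<lambda>\<omega>. restrict (\<lambda>j. Y j \<omega>) D) =
        (\<lambda>\<omega>. joint_brw (\<lambda>j. Z i j \<omega>) n)"
      by (auto simp: fun_eq_iff Z_def D_def intro!: joint_brw_cong split: if_splits)
    finally have ind: "indep_var borel (\<lambda>\<omega>. ereal (Y (True, [i]) \<omega>)) borel (\<lambda>\<omega>. joint_brw (\<lambda>j. Z i j \<omega>) n)"
      by (simp add: comp_def)
    let ?T = "\<lambda>\<omega>. joint_brw (\<lambda>j. Z i j \<omega>) n"
    let ?X = "\<lambda>\<omega>. ereal (Y (True, [i]) \<omega>)"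
    have [measurable]: "random_variable borel ?T"
      using ind by (rule indep_var_rv2)
    have [measurable]: "random_variable borel (Y (True, [i]))"
      by (rule rv) (simp add: I_def)
    interpret T: prob_space "distr M borel ?T"
      by (rule prob_space_distr) measurable
    let ?S = "{z \<in> space (borel \<Otimes>\<^sub>M borel). snd z \<le> ereal s - fst z}"
    have S: "?S \<in> sets (borel \<Otimes>\<^sub>M borel)"
      by measurable
    have "emeasure M (A i) = emeasure (distr M (borel \<Otimes>\<^sub>M borel) (\<lambda>\<omega>. (?X \<omega>, ?T \<omega>))) ?S"
      by (subst emeasure_distr[OF _ S]) (auto simp: A_def space_pair_measure intro!: arg_cong[where f = "emeasure M"])
    also have "\<dots> = emeasure (distr M borel ?X \<Otimes>\<^sub>M distr M borel ?T) ?S"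
      using ind by (simp add: indep_var_distribution_eq)
    also have "\<dots> = (\<integral>\<^sup>+x. emeasure (distr M borel ?T) (Pair x -` ?S) \<partial>distr M borel ?X)"
      using S by (intro T.emeasure_pair_measure_alt) (auto cong: sets_pair_measure_cong)
    also have "\<dots> = (\<integral>\<^sup>+\<omega>. emeasure (distr M borel ?T) (Pair (?X \<omega>) -` ?S) \<partial>M)"
      by (intro nn_integral_distr) (auto intro!: T.measurable_emeasure_Pair S cong: sets_pair_measure_cong)
    also have "\<dots> = (\<integral>\<^sup>+\<omega>. ennreal (brw_cdf p \<mu> n (s - Y (True, [i]) \<omega>)) \<partial>M)"
    proof (intro nn_integral_cong)
      fix \<omega>'
      have "emeasure (distr M borel ?T) (Pair (?X \<omega>') -` ?S) =
          emeasure M {\<omega> \<in> space M. ?T \<omega> \<le> ereal (s - Y (True, [i]) \<omega>')}"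
        by (subst emeasure_distr) (auto simp: space_pair_measure intro!: arg_cong[where f = "emeasure M"])
      then show "emeasure (distr M borel ?T) (Pair (?X \<omega>') -` ?S) =
          ennreal (brw_cdf p \<mu> n (s - Y (True, [i]) \<omega>'))"
        by (simp add: emeasure_eq_measure Z_le)
    qed
    also have "\<dots> = (\<integral>\<^sup>+x. ennreal (brw_cdf p \<mu> n (s - x)) \<partial>distr M borel (Y (True, [i])))"
      by (subst nn_integral_distr) auto
    also have "distr M borel (Y (True, [i])) = \<mu>"
      by (simp add: Suc.prems(3))
    also have "(\<integral>\<^sup>+x. ennreal (brw_cdf p \<mu> n (s - x)) \<partial>\<mu>) = ennreal (\<integral>x. brw_cdf p \<mu> n (s - x) \<partial>\<mu>)"
      by (intro nn_integral_eq_integral \<mu>.integrable_brw_cdf) (simp add: \<mu>.brw_cdf_nonneg)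
    finally show ?thesis
      by (simp add: emeasure_eq_measure \<mu>.brw_cdf_nonneg)
  qed
  define q where "q = (\<integral>x. brw_cdf p \<mu> n (s - x) \<partial>\<mu>)"
  have q: "0 \<le> q" "q \<le> 1"
    using \<mu>.integral_le_const[OF \<mu>.integrable_brw_cdf, of p n s 1]
    by (auto simp: q_def \<mu>.brw_cdf_nonneg \<mu>.brw_cdf_le_1)
  \<comment> \<open>One block for the offspring number of the root and one for each potential child,
    now including its displacement. All potential children are listed since the number of actual
    ones is random.\<close>
  define B where "B = case_option {(False, [])} (\<lambda>i. {(a, i # u) |a u. True} :: (bool \<times> nat list) set)"
  define V :: "nat option \<Rightarrow> (bool \<times> nat list \<Rightarrow> real) \<Rightarrow> real" where
    "V = case_option (\<lambda>g. g (False, []))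
      (\<lambda>i g. indicator {g. joint_brw (\<lambda>(a, u). g (a, i # u)) n \<le> ereal (s - g (True, [i]))} g)"
  have "indep_vars (\<lambda>j. PiM (B j) (\<lambda>_. borel)) (\<lambda>j \<omega>. restrict (\<lambda>i. Y i \<omega>) (B j)) UNIV"
    by (rule indep_vars_restrict[OF indep])
      (auto simp: B_def I_def disjoint_family_on_def split: option.splits)
  then have V: "indep_vars (\<lambda>_. borel) (\<lambda>j \<omega>. V j (restrict (\<lambda>i. Y i \<omega>) (B j))) UNIV"
  proof (rule indep_vars_compose2)
    fix j
    show "V j \<in> measurable (PiM (B j) (\<lambda>_. borel)) borel"
    proof (cases j)
      case None
      then show ?thesis
        by (auto simp: V_def B_def intro: measurable_component_singleton)
    next
      case (Some i)
      have f: "(\<lambda>g. joint_brw (\<lambda>(a, u). g (a, i # u)) n) \<in> borel_measurable (PiM (B (Some i)) (\<lambda>_. borel))"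
        by (auto intro!: borel_measurable_joint_brw measurable_component_singleton simp: B_def)
      have "(\<lambda>g. g (True, [i])) \<in> borel_measurable (PiM (B (Some i)) (\<lambda>_. borel))"
        by (auto intro!: measurable_component_singleton simp: B_def)
      then have "(\<lambda>g. ereal (s - g (True, [i]))) \<in> borel_measurable (PiM (B (Some i)) (\<lambda>_. borel))"
        by (intro borel_measurable_ereal borel_measurable_diff borel_measurable_const)
      with f have "Measurable.pred (PiM (B (Some i)) (\<lambda>_. borel))
          (\<lambda>g. joint_brw (\<lambda>(a, u). g (a, i # u)) n \<le> ereal (s - g (True, [i])))"
        unfolding pred_def by (rule borel_measurable_le)
      then show ?thesis
        unfolding V_def Some option.case by (intro borel_measurable_indicator') simp
    qed
  qed
  have VN: "V None (restrict (\<lambda>i. Y i \<omega>) (B None)) = Y (False, []) \<omega>" for \<omega>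
    by (simp add: V_def B_def)
  have VS: "V (Some i) (restrict (\<lambda>j. Y j \<omega>) (B (Some i))) = indicator (A i) \<omega>" if "\<omega> \<in> space M" for i \<omega>
  proof -
    have "joint_brw (\<lambda>(a, u). restrict (\<lambda>j. Y j \<omega>) (B (Some i)) (a, i # u)) n = joint_brw (\<lambda>j. Z i j \<omega>) n"
      by (auto simp: B_def Z_def intro!: joint_brw_cong)
    then show ?thesis
      using that by (auto simp: V_def B_def A_def indicator_def)
  qed
  define E where "E k = {\<omega> \<in> space M. Y (False, []) \<omega> = real k \<and> (\<forall>i<k. \<omega> \<in> A i)}" for k
  have pk: "prob {\<omega> \<in> space M. Y (False, []) \<omega> = real k} = pmf p k" for k
  proof -
    have "prob {\<omega> \<in> space M. Y (False, []) \<omega> = real k} = measure (distr M borel (Y (False, []))) {real k}"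
      by (subst measure_distr) (auto simp: I_def intro!: rv arg_cong[where f = prob])
    also have "\<dots> = measure (distr (measure_pmf p) borel real) {real k}"
      by (simp add: Suc.prems(2))
    also have "\<dots> = pmf p k"
      by (subst measure_distr) (auto simp: vimage_def measure_pmf_single)
    finally show ?thesis .
  qed
  have E: "prob (E k) = pmf p k * q ^ k" for k
  proof -
    \<comment> \<open>Prescribing the value \<open>k\<close> for the offspring number and the value
      1 for the indicators of the \<open>A i\<close> writes \<open>E k\<close> as an intersection
      over independent variables.\<close>
    define C where "C = case_option {real k} (\<lambda>i::nat. {1::real})"
    let ?J = "insert None (Some ` {..<k})"
    let ?W = "\<lambda>j \<omega>. V j (restrict (\<lambda>i. Y i \<omega>) (B j))"
    have W: "?W (Some i) -` C (Some i) \<inter> space M = A i" for i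
      by (auto simp: VS C_def A_def indicator_def split: if_splits)
    have "E k = (\<Inter>j\<in>?J. ?W j -` C j \<inter> space M)"
      by (auto simp: E_def C_def VN VS indicator_def split: if_splits)
    then have "prob (E k) = (\<Prod>j\<in>?J. prob (?W j -` C j \<inter> space M))"
      using indep_varsD[OF V, of ?J C] by (simp add: C_def split: option.split)
    also have "\<dots> = prob (?W None -` C None \<inter> space M) * (\<Prod>i<k. prob (?W (Some i) -` C (Some i) \<inter> space M))"
      by (subst prod.insert) (auto simp: prod.reindex)
    also have "?W None -` C None \<inter> space M = {\<omega> \<in> space M. Y (False, []) \<omega> = real k}"
      by (auto simp: VN C_def)
    finally show ?thesis
      unfolding W pk A q_def by simp
  qed
  have [measurable]: "A i \<in> events" for i
  proof -
    have [measurable]: "random_variable borel (\<lambda>\<omega>. joint_brw (\<lambda>j. Z i j \<omega>) n)"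
      by (intro borel_measurable_joint_brw) (auto simp: Z_def I_def intro!: rv)
    have [measurable]: "random_variable borel (Y (True, [i]))"
      by (rule rv) (simp add: I_def)
    show ?thesis
      unfolding A_def by measurable
  qed
  have [measurable]: "random_variable borel (Y (False, []))"
    by (rule rv) (simp add: I_def)
  have E_sets: "E k \<in> events" for k
    unfolding E_def by measurable
  \<comment> \<open>The offspring number is here a real variable given only through its law, so it
    is a natural number only almost surely.\<close>
  have "AE \<omega> in M. Y (False, []) \<omega> \<in> range real"
  proof -
    have [measurable]: "range real \<in> sets borel"
      by (rule sets.countable) auto
    have "AE x in distr M borel (Y (False, [])). x \<in> range real"
      unfolding Suc.prems(2) by (subst AE_distr_iff) auto
    then show ?thesis
      by (subst (asm) AE_distr_iff) auto
  qed
  then have "prob {\<omega> \<in> space M. joint_brw (\<lambda>j. Y j \<omega>) (Suc n) \<le> ereal s} = prob (\<Union>k. E k)"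
  proof (intro measure_eq_AE, elim AE_mp, intro AE_I2 impI)
    fix \<omega> assume "\<omega> \<in> space M" "Y (False, []) \<omega> \<in> range real"
    then obtain k where k: "Y (False, []) \<omega> = real k"
      by auto
    then show "\<omega> \<in> {\<omega> \<in> space M. joint_brw (\<lambda>j. Y j \<omega>) (Suc n) \<le> ereal s} \<longleftrightarrow> \<omega> \<in> (\<Union>k. E k)"
      using \<open>\<omega> \<in> space M\<close>
      by (auto simp: joint_brw_Suc_le_iff[where y = "\<lambda>j. Y j \<omega>", OF k] E_def A_def Z_def case_prod_unfold)
  next
    have [measurable]: "random_variable borel (\<lambda>\<omega>. joint_brw (\<lambda>j. Y j \<omega>) (Suc n))"
      by (intro borel_measurable_joint_brw) (auto simp: I_def intro!: rv)
    show "{\<omega> \<in> space M. joint_brw (\<lambda>j. Y j \<omega>) (Suc n) \<le> ereal s} \<in> events"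
      by measurable
  qed (use E_sets in auto)
  moreover have "(\<lambda>k. prob (E k)) sums prob (\<Union>k. E k)"
    using E_sets by (intro finite_measure_UNION) (auto simp: disjoint_family_on_def E_def)
  moreover have "(\<lambda>k. pmf p k * q ^ k) sums measure_pmf.expectation p (\<lambda>k. q ^ k)"
    using q by (intro sums_expectation_nat_pmf integrable_pmf_bounded[where B = 1]) (auto simp: power_le_one)
  ultimately have "prob {\<omega> \<in> space M. joint_brw (\<lambda>j. Y j \<omega>) (Suc n) \<le> ereal s} =
      measure_pmf.expectation p (\<lambda>k. q ^ k)"
    unfolding E by (metis sums_unique2)
  then show ?case
    by (simp add: q_def)
qed

section \<open>The branching random walk as one independent family\<close>

context branching_random_walk
begin

lemma random_variable_offspring: "random_variable (count_space UNIV) (N v)"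
  using offspring_indep by (auto simp: indep_vars_def)

lemma random_variable_displacement: "v \<noteq> [] \<Longrightarrow> random_variable borel (X v)"
  using displacement_indep by (auto simp: indep_vars_def)

text \<open>A finite set of indices splits into offspring numbers \<open>J0\<close> and
  displacements \<open>J1\<close>. Independence of the two families gives a product of two
  probabilities, and independence within each family factors these further.\<close>

lemma indep_vars_joint:
  "indep_vars (\<lambda>_. borel) (\<lambda>(b, v). if b then X v else (\<lambda>\<omega>. real (N v \<omega>))) (UNIV - {(True, [])})"
  (is "indep_vars _ ?Y _")
  unfolding indep_vars_def2
proof (intro conjI ballI indep_setsI)
  let ?I = "UNIV - {(True, [] :: nat list)}"
  show rv: "random_variable borel (?Y j)" if "j \<in> ?I" for j
  proof -
    have "random_variable borel (\<lambda>\<omega>. real (N v \<omega>))" for v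
      by (rule measurable_compose[OF random_variable_offspring]) simp
    with that show ?thesis
      by (auto intro!: random_variable_displacement split: prod.splits)
  qed
  show "{?Y j -` A \<inter> space M |A. A \<in> sets borel} \<subseteq> events" if "j \<in> ?I" for j
    using rv[OF that] by (auto intro: measurable_sets)
  fix E J
  assume J: "J \<noteq> {}" "J \<subseteq> ?I" "finite J"
    and E: "\<forall>j\<in>J. E j \<in> {?Y j -` A \<inter> space M |A. A \<in> sets borel}"
  have "\<exists>A. \<forall>j\<in>J. A j \<in> sets borel \<and> E j = ?Y j -` A j \<inter> space M"
    by (intro bchoice ballI) (use E in blast)
  then obtain A where A: "\<And>j. j \<in> J \<Longrightarrow> A j \<in> sets borel" "\<And>j. j \<in> J \<Longrightarrow> E j = ?Y j -` A j \<inter> space M"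
    by blast
  define J0 where "J0 = {v. (False, v) \<in> J}"
  define J1 where "J1 = {v. (True, v) \<in> J}"
  have J_eq: "J = Pair False ` J0 \<union> Pair True ` J1"
    unfolding J0_def J1_def by (auto simp: image_iff) (metis (full_types))
  have fin: "finite J0" "finite J1"
    using J(3) unfolding J_eq by (auto dest: finite_imageD simp: inj_on_def)
  have J1: "J1 \<subseteq> {v. v \<noteq> []}"
    using J(2) by (auto simp: J1_def)
  \<comment> \<open>\<^const>\<open>indep_var\<close> relates variables of equal type, so in the locale assumption the offspring numbers are
    silently coerced to real functions on words.\<close>
  define P0 where "P0 = {g \<in> space (PiM UNIV (\<lambda>_ :: nat list. count_space (UNIV :: real set))). \<forall>v\<in>J0. g v \<in> A (False, v)}"
  define P1 where "P1 = {g \<in> space (PiM {v :: nat list. v \<noteq> []} (\<lambda>_. borel)). \<forall>v\<in>J1. g v \<in> A (True, v)}"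
  have P0: "P0 \<in> sets (PiM UNIV (\<lambda>_. count_space UNIV))"
    unfolding P0_def using fin by (intro sets.sets_Collect_finite_All sets_Collect_single) auto
  have P1: "P1 \<in> sets (PiM {v. v \<noteq> []} (\<lambda>_. borel))"
  proof -
    have "{g \<in> space (PiM {v :: nat list. v \<noteq> []} (\<lambda>_. borel)). g v \<in> A (True, v)} \<in> sets (PiM {v. v \<noteq> []} (\<lambda>_. borel))"
      if "v \<in> J1" for v
      using that J1 A(1)[of "(True, v)"]
      by (intro sets_Collect_single) (auto simp: J1_def)
    then show ?thesis
      unfolding P1_def using fin by (intro sets.sets_Collect_finite_All) auto
  qed
  have prod0: "prob {\<omega> \<in> space M. \<forall>v\<in>J0. real (N v \<omega>) \<in> A (False, v)} = (\<Prod>v\<in>J0. prob (E (False, v)))"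
  proof (cases "J0 = {}")
    case False
    have "prob (\<Inter>v\<in>J0. N v -` {k. real k \<in> A (False, v)} \<inter> space M) =
        (\<Prod>v\<in>J0. prob (N v -` {k. real k \<in> A (False, v)} \<inter> space M))"
      using False fin by (intro indep_varsD[OF offspring_indep]) auto
    also have "(\<Inter>v\<in>J0. N v -` {k. real k \<in> A (False, v)} \<inter> space M) =
        {\<omega> \<in> space M. \<forall>v\<in>J0. real (N v \<omega>) \<in> A (False, v)}"
      using False by auto
    also have "(\<Prod>v\<in>J0. prob (N v -` {k. real k \<in> A (False, v)} \<inter> space M)) = (\<Prod>v\<in>J0. prob (E (False, v)))"
      by (intro prod.cong) (auto simp: A(2) J0_def intro!: arg_cong[where f = prob])
    finally show ?thesis .
  qed (simp add: prob_space)
  have prod1: "prob {\<omega> \<in> space M. \<forall>v\<in>J1. X v \<omega> \<in> A (True, v)} = (\<Prod>v\<in>J1. prob (E (True, v)))"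
  proof (cases "J1 = {}")
    case False
    have "prob (\<Inter>v\<in>J1. X v -` A (True, v) \<inter> space M) = (\<Prod>v\<in>J1. prob (X v -` A (True, v) \<inter> space M))"
      using False fin J1 A(1) by (intro indep_varsD[OF displacement_indep]) (auto simp: J1_def)
    also have "(\<Inter>v\<in>J1. X v -` A (True, v) \<inter> space M) = {\<omega> \<in> space M. \<forall>v\<in>J1. X v \<omega> \<in> A (True, v)}"
      using False by auto
    also have "(\<Prod>v\<in>J1. prob (X v -` A (True, v) \<inter> space M)) = (\<Prod>v\<in>J1. prob (E (True, v)))"
      by (intro prod.cong) (auto simp: A(2) J1_def)
    finally show ?thesis .
  qed (simp add: prob_space)
  have "(\<Inter>j\<in>J. E j) = (\<lambda>\<omega>. (\<lambda>v. real ((\<lambda>v\<in>UNIV. N v \<omega>) v), \<lambda>v\<in>{v. v \<noteq> []}. X v \<omega>)) -` (P0 \<times> P1) \<inter> space M"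
  proof -
    have "(\<Inter>j\<in>J. E j) = {\<omega> \<in> space M. \<forall>j\<in>J. ?Y j \<omega> \<in> A j}"
      using J(1) by (auto simp: A(2))
    also have "\<dots> = {\<omega> \<in> space M. (\<forall>v\<in>J0. real (N v \<omega>) \<in> A (False, v)) \<and> (\<forall>v\<in>J1. X v \<omega> \<in> A (True, v))}"
      unfolding J_eq by (simp add: ball_Un)
    also have "\<dots> = (\<lambda>\<omega>. (\<lambda>v. real ((\<lambda>v\<in>UNIV. N v \<omega>) v), \<lambda>v\<in>{v. v \<noteq> []}. X v \<omega>)) -` (P0 \<times> P1) \<inter> space M"
      using J1 by (auto simp: P0_def P1_def space_PiM subset_eq)
    finally show ?thesis .
  qed
  then have "prob (\<Inter>j\<in>J. E j) = prob ((\<lambda>\<omega> v. real ((\<lambda>v\<in>UNIV. N v \<omega>) v)) -` P0 \<inter> space M) *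
      prob ((\<lambda>\<omega>. \<lambda>v\<in>{v. v \<noteq> []}. X v \<omega>) -` P1 \<inter> space M)"
    using indep_varD[OF offspring_displacement_indep P0 P1] by simp
  also have "(\<lambda>\<omega> v. real ((\<lambda>v\<in>UNIV. N v \<omega>) v)) -` P0 \<inter> space M = {\<omega> \<in> space M. \<forall>v\<in>J0. real (N v \<omega>) \<in> A (False, v)}"
    by (auto simp: P0_def space_PiM)
  also have "(\<lambda>\<omega>. \<lambda>v\<in>{v. v \<noteq> []}. X v \<omega>) -` P1 \<inter> space M = {\<omega> \<in> space M. \<forall>v\<in>J1. X v \<omega> \<in> A (True, v)}"
    using J1 by (auto simp: P1_def space_PiM subset_eq)
  also have "prob {\<omega> \<in> space M. \<forall>v\<in>J0. real (N v \<omega>) \<in> A (False, v)} *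
      prob {\<omega> \<in> space M. \<forall>v\<in>J1. X v \<omega> \<in> A (True, v)} = (\<Prod>j\<in>J. prob (E j))"
    unfolding prod0 prod1 J_eq using fin
    by (subst prod.union_disjoint) (auto simp: prod.reindex inj_on_def)
  finally show "prob (\<Inter>j\<in>J. E j) = (\<Prod>j\<in>J. prob (E j))" .
qed

lemma prob_brw_max_le:
  "prob {\<omega> \<in> space M. brw_max (\<lambda>v. N v \<omega>) (\<lambda>v. X v \<omega>) n \<le> ereal s} = brw_cdf p step n s"
proof -
  let ?Y = "\<lambda>(b, v). if b then X v else (\<lambda>\<omega>. real (N v \<omega>))"
  have "distr M borel (\<lambda>\<omega>. real (N v \<omega>)) = distr (measure_pmf p) borel real" for v
    unfolding offspring_law[symmetric, of v]
    by (subst distr_distr) (auto simp: random_variable_offspring comp_def)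
  then have "prob {\<omega> \<in> space M. joint_brw (\<lambda>j. ?Y j \<omega>) n \<le> ereal s} = brw_cdf p step n s"
    by (intro prob_joint_brw_le indep_vars_joint) (auto simp: displacement_law)
  moreover have "joint_brw (\<lambda>j. ?Y j \<omega>) n = brw_max (\<lambda>v. N v \<omega>) (\<lambda>v. X v \<omega>) n" for \<omega>
    by (simp add: joint_brw_def)
  ultimately show ?thesis
    by simp
qed

lemma real_distribution_step: "real_distribution step"
proof -
  have "prob_space step"
    using prob_space_distr[OF random_variable_displacement[of "[0]"]] displacement_law[of "[0]"] by simp
  moreover have "sets step = sets borel" "space step = UNIV"
    using displacement_law[of "[0]"] by auto
  ultimately show ?thesis
    by (simp add: real_distribution_def real_distribution_axioms_def)
qed

end

subsection \<open>Bounds from the generating function\<close>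

text \<open>Bonferroni inequalities for a union of \<open>k\<close> independent events of
  probability \<open>u\<close>, with a generous quadratic term in the lower one.\<close>

lemma one_minus_power_bounds:
  fixes u :: real
  assumes "0 \<le> u" "u \<le> 1"
  shows "1 - (1 - u) ^ k \<le> real k * u"
    and "real k * u - (real k * u)\<^sup>2 \<le> 1 - (1 - u) ^ k"
proof -
  show "1 - (1 - u) ^ k \<le> real k * u"
    using Bernoulli_inequality[of "- u" k] assms by simp
  show "real k * u - (real k * u)\<^sup>2 \<le> 1 - (1 - u) ^ k"
  proof (induction k)
    case (Suc k)
    have "(1 - u) ^ Suc k \<le> (1 - u) * (1 - real k * u + (real k * u)\<^sup>2)"
      using Suc assms by (auto intro!: mult_left_mono)
    also have "\<dots> = 1 - real (Suc k) * u + (real k * u)\<^sup>2 + real k * u\<^sup>2 - u * (real k * u)\<^sup>2"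
      by (simp add: algebra_simps power2_eq_square)
    also have "\<dots> \<le> 1 - real (Suc k) * u + (real (Suc k) * u)\<^sup>2"
    proof -
      have "(real (Suc k) * u)\<^sup>2 = (real k * u)\<^sup>2 + real k * u\<^sup>2 + real k * u\<^sup>2 + u\<^sup>2"
        by (simp add: algebra_simps power2_eq_square)
      moreover have "0 \<le> u * (real k * u)\<^sup>2" "0 \<le> real k * u\<^sup>2 + u\<^sup>2"
        using assms by auto
      ultimately show ?thesis
        by linarith
    qed
    finally show ?case
      by simp
  qed simp
qed

text \<open>The complement has slope m at \<open>u = 0\<close>, but the second moment of
  \<open>p\<close> may be infinite. Keeping finitely many \<open>k\<close>, with partial mean
  \<open>m''\<close> still above \<open>m'\<close>, bounds the quadratic error by
  \<open>C * u\<^sup>2\<close>; up to \<open>u0\<close> this is at most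
  \<open>(m'' - m') * u\<close>, and beyond \<open>u0\<close> monotonicity suffices. The
  \<open>+ 1\<close> in \<open>C\<close> makes it a legal divisor.\<close>

lemma pgf_complement_lower_bound:
  assumes m: "integrable (measure_pmf p) real" "m' < measure_pmf.expectation p real" "0 \<le> m'"
  obtains u0 where "0 < u0" "u0 \<le> 1"
    "\<And>u. 0 \<le> u \<Longrightarrow> u \<le> 1 \<Longrightarrow> m' * min u u0 \<le> 1 - measure_pmf.expectation p (\<lambda>k. (1 - u) ^ k)"
proof -
  have "(\<lambda>n. \<Sum>k<n. pmf p k * real k) \<longlonglongrightarrow> measure_pmf.expectation p real"
    using sums_expectation_nat_pmf[OF m(1)] by (simp add: sums_def)
  then have "eventually (\<lambda>n. m' < (\<Sum>k<n. pmf p k * real k)) sequentially"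
    using m(2) by (rule order_tendstoD)
  then obtain n where n: "m' < (\<Sum>k<n. pmf p k * real k)"
    by (meson eventually_sequentially le_refl)
  define m'' where "m'' = (\<Sum>k<n. pmf p k * real k)"
  define C where "C = (\<Sum>k<n. pmf p k * (real k)\<^sup>2) + 1"
  have "0 \<le> (\<Sum>k<n. pmf p k * (real k)\<^sup>2)"
    by (intro sum_nonneg) auto
  then have C: "C > 0"
    by (simp add: C_def)
  define u0 where "u0 = min 1 ((m'' - m') / C)"
  have u0: "0 < u0" "u0 \<le> 1" "u0 * C \<le> m'' - m'"
    using n C by (auto simp: u0_def m''_def min_def field_simps)
  have int: "integrable (measure_pmf p) (\<lambda>k. (1 - u) ^ k)" if "0 \<le> u" "u \<le> 1" for u :: real
    using that by (intro integrable_pmf_bounded[where B = 1]) (auto simp: power_le_one)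
  have small: "m' * u \<le> 1 - measure_pmf.expectation p (\<lambda>k. (1 - u) ^ k)" if u: "0 \<le> u" "u \<le> u0" for u
  proof -
    have u1: "u \<le> 1"
      using u u0 by linarith
    have "integrable (measure_pmf p) (\<lambda>k. 1 - (1 - u) ^ k)"
      using int[OF u(1) u1] by simp
    then have sums: "(\<lambda>k. pmf p k * (1 - (1 - u) ^ k)) sums measure_pmf.expectation p (\<lambda>k. 1 - (1 - u) ^ k)"
      by (rule sums_expectation_nat_pmf)
    have "m' * u \<le> m'' * u - C * u\<^sup>2"
    proof -
      have "C * u\<^sup>2 \<le> C * (u * u0)"
        using C u by (auto simp: power2_eq_square intro!: mult_left_mono)
      also have "\<dots> = u * (u0 * C)"
        by simp
      also have "\<dots> \<le> u * (m'' - m')"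
        using u u0 by (intro mult_left_mono) auto
      finally show ?thesis
        by (simp add: algebra_simps)
    qed
    also have "\<dots> \<le> m'' * u - (C - 1) * u\<^sup>2"
      by (simp add: algebra_simps)
    also have "\<dots> = (\<Sum>k<n. pmf p k * (real k * u - (real k * u)\<^sup>2))"
      unfolding m''_def C_def
      by (simp add: sum_distrib_right right_diff_distrib sum_subtractf power_mult_distrib mult.assoc)
    also have "\<dots> \<le> (\<Sum>k<n. pmf p k * (1 - (1 - u) ^ k))"
      using one_minus_power_bounds(2)[OF u(1) u1] by (intro sum_mono mult_left_mono) auto
    also have "\<dots> \<le> measure_pmf.expectation p (\<lambda>k. 1 - (1 - u) ^ k)"
      unfolding sums_unique[OF sums] using u u1
      by (intro sum_le_suminf sums_summable[OF sums]) (auto intro!: mult_nonneg_nonneg simp: power_le_one)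
    also have "\<dots> = 1 - measure_pmf.expectation p (\<lambda>k. (1 - u) ^ k)"
      using int[OF u(1) u1] by simp
    finally show ?thesis .
  qed
  have "m' * min u u0 \<le> 1 - measure_pmf.expectation p (\<lambda>k. (1 - u) ^ k)" if u: "0 \<le> u" "u \<le> 1" for u
  proof (cases "u \<le> u0")
    case True
    then show ?thesis
      using small u by simp
  next
    case False
    have "measure_pmf.expectation p (\<lambda>k. (1 - u) ^ k) \<le> measure_pmf.expectation p (\<lambda>k. (1 - u0) ^ k)"
      using False u u0 by (intro integral_mono int power_mono) auto
    then show ?thesis
      using small[of u0] u0 False by simp
  qed
  with u0 that show ?thesis
    by blast
qed

context real_distribution
begin

lemma expectation_brw_cdf_bounds:
  "0 \<le> expectation (\<lambda>x. brw_cdf p M n (y - x))" "expectation (\<lambda>x. brw_cdf p M n (y - x)) \<le> 1"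
  using integral_le_const[OF integrable_brw_cdf, of p n y 1]
  by (auto simp: brw_cdf_nonneg brw_cdf_le_1)

lemma integrable_pmf_power_expectation_brw_cdf:
  "integrable (measure_pmf p') (\<lambda>k. expectation (\<lambda>x. brw_cdf p M n (y - x)) ^ k)"
  using expectation_brw_cdf_bounds
  by (intro integrable_pmf_bounded[where B = 1]) (auto simp: power_le_one)

lemma brw_cdf_Suc_le:
  assumes "AE x in M. - L \<le> x" and "\<And>k. k < b \<Longrightarrow> pmf p k = 0"
  shows "brw_cdf p M (Suc n) y \<le> brw_cdf p M n (y + L) ^ b"
proof -
  define q where "q = expectation (\<lambda>x. brw_cdf p M n (y - x))"
  have q: "0 \<le> q" "q \<le> 1"
    using expectation_brw_cdf_bounds by (auto simp: q_def)
  have "AE x in M. brw_cdf p M n (y - x) \<le> brw_cdf p M n (y + L)"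
    using assms(1) by eventually_elim (auto intro: brw_cdf_mono)
  then have "q \<le> brw_cdf p M n (y + L)"
    unfolding q_def by (intro integral_le_const integrable_brw_cdf)
  have "brw_cdf p M (Suc n) y = measure_pmf.expectation p (\<lambda>k. q ^ k)"
    by (simp add: q_def)
  also have "\<dots> \<le> q ^ b"
  proof (rule measure_pmf.integral_le_const)
    show "integrable (measure_pmf p) (\<lambda>k. q ^ k)"
      unfolding q_def by (rule integrable_pmf_power_expectation_brw_cdf)
    show "AE k in measure_pmf p. q ^ k \<le> q ^ b"
    proof (rule AE_pmfI)
      fix k assume "k \<in> set_pmf p"
      then have "b \<le> k"
        using assms(2)[of k] by (auto simp: set_pmf_iff intro: leI)
      then show "q ^ k \<le> q ^ b"
        using q by (intro power_decreasing)
    qed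
  qed
  also have "\<dots> \<le> brw_cdf p M n (y + L) ^ b"
    using q \<open>q \<le> brw_cdf p M n (y + L)\<close> by (intro power_mono)
  finally show ?thesis .
qed

lemma brw_cdf_add_le:
  assumes "AE x in M. - L \<le> x" and "\<And>k. k < b \<Longrightarrow> pmf p k = 0"
  shows "brw_cdf p M (n + j) y \<le> brw_cdf p M n (y + real j * L) ^ (b ^ j)"
proof (induction j arbitrary: y)
  case (Suc j)
  have "brw_cdf p M (n + Suc j) y \<le> brw_cdf p M (n + j) (y + L) ^ b"
    using brw_cdf_Suc_le[OF assms] by (metis add_Suc_right)
  also have "\<dots> \<le> (brw_cdf p M n (y + L + real j * L) ^ (b ^ j)) ^ b"
    by (intro power_mono Suc brw_cdf_nonneg)
  also have "\<dots> = brw_cdf p M n (y + real (Suc j) * L) ^ (b ^ Suc j)"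
    by (simp add: power_mult[symmetric] algebra_simps)
  finally show ?case .
qed simp

text \<open>Only the event is kept that the root has exactly \<open>b\<close> children and that each
  of them moves to \<open>- l\<close> or below.\<close>

lemma brw_cdf_Suc_ge:
  "pmf p b * (prob {x. x \<le> - l} * brw_cdf p M n (y + l)) ^ b \<le> brw_cdf p M (Suc n) y"
proof -
  define q where "q = expectation (\<lambda>x. brw_cdf p M n (y - x))"
  have q: "0 \<le> q"
    using expectation_brw_cdf_bounds by (auto simp: q_def)
  have "prob {x. x \<le> - l} * brw_cdf p M n (y + l) = expectation (\<lambda>x. indicator {x. x \<le> - l} x * brw_cdf p M n (y + l))"
    by simp
  also have "\<dots> \<le> q"
    unfolding q_def
  proof (intro integral_mono integrable_brw_cdf)
    show "integrable M (\<lambda>x. indicator {x. x \<le> - l} x * brw_cdf p M n (y + l))"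
      by (intro integrable_mult_left integrable_real_indicator) (auto simp: emeasure_eq_measure)
  qed (auto simp: indicator_def brw_cdf_nonneg intro!: brw_cdf_mono)
  finally have "pmf p b * (prob {x. x \<le> - l} * brw_cdf p M n (y + l)) ^ b \<le> pmf p b * q ^ b"
    by (intro mult_left_mono power_mono) (auto simp: brw_cdf_nonneg)
  also have "\<dots> = measure_pmf.expectation p (\<lambda>k. indicator {b} k * q ^ b)"
    by (simp add: measure_pmf_single)
  also have "\<dots> \<le> measure_pmf.expectation p (\<lambda>k. q ^ k)"
    using q by (intro integral_mono integrable_mult_left)
      (auto simp: indicator_def q_def intro!: integrable_pmf_power_expectation_brw_cdf integrable_pmf_bounded[where B = 1])
  also have "\<dots> = brw_cdf p M (Suc n) y"
    by (simp add: q_def)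
  finally show ?thesis .
qed

text \<open>Every generation produces a new constant factor. Multiplying the distribution function
  by \<open>\<kappa>\<close> absorbs them all into the base of the power, because
  \<open>\<kappa> ^ b \<le> \<kappa>\<^sup>2\<close> when \<open>\<kappa> \<le> 1\<close> and
  \<open>b \<ge> 2\<close>.\<close>

lemma brw_cdf_add_ge:
  fixes p :: "nat pmf" and b :: nat and l :: real
  assumes "2 \<le> b"
  defines "\<kappa> \<equiv> pmf p b * prob {x. x \<le> - l} ^ b"
  shows "(\<kappa> * brw_cdf p M n (y + real j * l)) ^ (b ^ j) \<le> \<kappa> * brw_cdf p M (n + j) y"
proof (induction j arbitrary: y)
  case (Suc j)
  have \<kappa>: "0 \<le> \<kappa>" "\<kappa> \<le> 1"
    by (auto simp: \<kappa>_def mult_le_one power_le_one pmf_le_1)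
  have "(\<kappa> * brw_cdf p M n (y + real (Suc j) * l)) ^ (b ^ Suc j) =
      ((\<kappa> * brw_cdf p M n (y + l + real j * l)) ^ (b ^ j)) ^ b"
    by (simp add: power_mult[symmetric] algebra_simps)
  also have "\<dots> \<le> (\<kappa> * brw_cdf p M (n + j) (y + l)) ^ b"
    using \<kappa> by (intro power_mono Suc) (auto simp: brw_cdf_nonneg)
  also have "\<dots> = \<kappa> ^ b * brw_cdf p M (n + j) (y + l) ^ b"
    by (rule power_mult_distrib)
  also have "\<dots> \<le> \<kappa>\<^sup>2 * brw_cdf p M (n + j) (y + l) ^ b"
    using \<kappa> assms(1) by (intro mult_right_mono power_decreasing) (auto simp: brw_cdf_nonneg)
  also have "\<dots> = \<kappa> * (pmf p b * (prob {x. x \<le> - l} * brw_cdf p M (n + j) (y + l)) ^ b)"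
    by (simp add: power2_eq_square \<kappa>_def power_mult_distrib)
  also have "\<dots> \<le> \<kappa> * brw_cdf p M (n + Suc j) y"
    using brw_cdf_Suc_ge[of p b l "n + j" y] \<kappa> by (intro mult_left_mono) auto
  finally show ?case .
qed simp

text \<open>Chernoff's bound for the expected number of vertices of generation \<open>n\<close>
  above \<open>y\<close>, obtained by iterating 1 - g(q) \<le> m(1 - q) instead of counting
  vertices.\<close>

lemma brw_cdf_first_moment:
  assumes "integrable (measure_pmf p) real" "0 \<le> t" "integrable M (\<lambda>x. exp (t * x))"
  shows "1 - brw_cdf p M n y \<le> (measure_pmf.expectation p real * expectation (\<lambda>x. exp (t * x))) ^ n * exp (- (t * y))"
proof (induction n arbitrary: y)
  case 0
  show ?case
    using assms(2) by (auto simp: mult_nonneg_nonpos)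
next
  case (Suc n)
  let ?m = "measure_pmf.expectation p real" and ?\<psi> = "expectation (\<lambda>x. exp (t * x))"
  define q where "q = expectation (\<lambda>x. brw_cdf p M n (y - x))"
  have q: "0 \<le> q" "q \<le> 1"
    using expectation_brw_cdf_bounds by (auto simp: q_def)
  have int: "integrable (measure_pmf p) (\<lambda>k. q ^ k)"
    unfolding q_def by (rule integrable_pmf_power_expectation_brw_cdf)
  have "1 - brw_cdf p M (Suc n) y = measure_pmf.expectation p (\<lambda>k. 1 - q ^ k)"
    using int by (simp add: q_def)
  also have "\<dots> \<le> measure_pmf.expectation p (\<lambda>k. real k * (1 - q))"
    using int assms(1) one_minus_power_bounds(1)[of "1 - q"] q by (intro integral_mono) auto
  also have "\<dots> = ?m * (1 - q)"
    by simp
  finally have *: "1 - brw_cdf p M (Suc n) y \<le> ?m * (1 - q)" .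
  have "1 - q = expectation (\<lambda>x. 1 - brw_cdf p M n (y - x))"
    using integrable_brw_cdf prob_space by (simp add: q_def)
  also have "\<dots> \<le> expectation (\<lambda>x. ((?m * ?\<psi>) ^ n * exp (- (t * y))) * exp (t * x))"
  proof (intro integral_mono)
    fix x
    have "1 - brw_cdf p M n (y - x) \<le> (?m * ?\<psi>) ^ n * exp (- (t * (y - x)))"
      by (rule Suc)
    also have "exp (- (t * (y - x))) = exp (- (t * y)) * exp (t * x)"
      by (simp add: exp_add[symmetric] algebra_simps)
    finally show "1 - brw_cdf p M n (y - x) \<le> (?m * ?\<psi>) ^ n * exp (- (t * y)) * exp (t * x)"
      by (simp add: mult.assoc)
  qed (use assms integrable_brw_cdf in auto)
  also have "\<dots> = (?m * ?\<psi>) ^ n * exp (- (t * y)) * ?\<psi>"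
    by simp
  finally have "?m * (1 - q) \<le> ?m * ((?m * ?\<psi>) ^ n * exp (- (t * y)) * ?\<psi>)"
    by (intro mult_left_mono) auto
  also have "\<dots> = (?m * ?\<psi>) ^ Suc n * exp (- (t * y))"
    by (simp only: power_Suc mult_ac)
  finally show ?case
    using * by linarith
qed

end

subsection \<open>Random walks and Cramer's lower bound\<close>

text \<open>\<open>walk_nn \<mu> n f s\<close> is the expectation of \<open>f (s + S\<^sub>n)\<close> for the random walk \<open>S\<close> with step law \<open>\<mu>\<close>.\<close>

primrec walk_nn :: "real measure \<Rightarrow> nat \<Rightarrow> (real \<Rightarrow> ennreal) \<Rightarrow> real \<Rightarrow> ennreal" where
  "walk_nn \<mu> 0 f s = f s"
| "walk_nn \<mu> (Suc n) f s = (\<integral>\<^sup>+x. walk_nn \<mu> n f (s + x) \<partial>\<mu>)"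

text \<open>The Taylor bound behind \<open>trunc_mgf_min_imp_mean_zero\<close>. For negative
  \<open>u\<close> it follows by multiplying a lower bound of \<open>exp (- u)\<close> with
  \<open>1 + u + u\<^sup>2\<close>.\<close>

lemma exp_le_quadratic:
  fixes u :: real
  assumes "\<bar>u\<bar> \<le> 1"
  shows "exp u \<le> 1 + u + u\<^sup>2"
proof (cases "0 \<le> u")
  case True
  then show ?thesis
    using exp_bound[of u] assms by simp
next
  case False
  define x where "x = - u"
  have x: "0 \<le> x"
    using False by (simp add: x_def)
  have "1 \<le> (1 - x + x\<^sup>2) * (1 + x + x\<^sup>2 / 2)"
  proof -
    have "(1 - x + x\<^sup>2) * (1 + x + x\<^sup>2 / 2) = 1 + x\<^sup>2 / 2 + x ^ 3 / 2 + x ^ 4 / 2"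
      by (simp add: field_simps power2_eq_square power3_eq_cube power4_eq_xxxx)
    then show ?thesis
      using x by simp
  qed
  also have "\<dots> \<le> (1 - x + x\<^sup>2) * exp x"
  proof (intro mult_left_mono)
    show "1 + x + x\<^sup>2 / 2 \<le> exp x"
      using x by (rule exp_lower_Taylor_quadratic)
    have "0 \<le> (x - 1/2)\<^sup>2 + 3/4"
      by (simp add: add_nonneg_nonneg)
    then show "0 \<le> 1 - x + x\<^sup>2"
      by (simp add: power2_eq_square algebra_simps)
  qed
  finally have "exp (- x) \<le> 1 - x + x\<^sup>2"
    by (simp add: exp_minus divide_simps)
  then show ?thesis
    by (simp add: x_def)
qed

context real_distribution
begin

lemma borel_measurable_walk_nn:
  assumes [measurable]: "f \<in> borel_measurable borel"
  shows "walk_nn M n f \<in> borel_measurable borel"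
proof (induction n)
  case 0
  then show ?case
    by simp
next
  case (Suc n)
  note Suc [measurable]
  have "(\<lambda>s. \<integral>\<^sup>+x. walk_nn M n f (s + x) \<partial>M) \<in> borel_measurable borel"
    by (rule borel_measurable_nn_integral) measurable
  then show ?case
    by simp
qed

lemma measurable_walk_nn_compose [measurable (raw)]:
  "f \<in> borel_measurable borel \<Longrightarrow> g \<in> borel_measurable N \<Longrightarrow> (\<lambda>x. walk_nn M n f (g x)) \<in> borel_measurable N"
  by (rule measurable_compose[OF _ borel_measurable_walk_nn])

lemma walk_nn_mono: "(\<And>u. f u \<le> g u) \<Longrightarrow> walk_nn M n f s \<le> walk_nn M n g s"
  by (induction n arbitrary: s) (auto intro: nn_integral_mono)

lemma walk_nn_add:
  assumes [measurable]: "f \<in> borel_measurable borel" "g \<in> borel_measurable borel"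
  shows "walk_nn M n (\<lambda>u. f u + g u) s = walk_nn M n f s + walk_nn M n g s"
  by (induction n arbitrary: s) (auto simp: nn_integral_add)

lemma walk_nn_cmult:
  assumes [measurable]: "f \<in> borel_measurable borel"
  shows "walk_nn M n (\<lambda>u. c * f u) s = c * walk_nn M n f s"
  by (induction n arbitrary: s) (auto simp: nn_integral_cmult)

lemma walk_nn_const: "walk_nn M n (\<lambda>_. c) s = c"
  using emeasure_space_1 by (induction n arbitrary: s) auto

lemma walk_nn_shift: "walk_nn M n (\<lambda>u. f (u + r)) s = walk_nn M n f (s + r)"
  by (induction n arbitrary: s) (auto simp: algebra_simps)

text \<open>Change of measure along \<open>n\<close> steps. An upper bound on the density is enough,
  which allows a density cut off outside a window, while the exponential weights telescope along the
  path.\<close>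

lemma walk_nn_density_le:
  assumes [measurable]: "f \<in> borel_measurable borel" "h \<in> borel_measurable borel"
    and h: "\<And>x. h x \<le> C * exp (t * x)"
    and \<nu>: "real_distribution (density M (\<lambda>x. ennreal (h x)))" and C: "0 \<le> C"
  shows "walk_nn (density M (\<lambda>x. ennreal (h x))) n f s \<le>
    ennreal (C ^ n * exp (- (t * s))) * walk_nn M n (\<lambda>u. f u * ennreal (exp (t * u))) s"
proof (induction n arbitrary: s)
  case 0
  have "ennreal (exp (- (t * s))) * (f s * ennreal (exp (t * s))) = f s"
    by (simp add: mult.left_commute ennreal_mult'[symmetric] exp_minus)
  then show ?case
    by simp
next
  case (Suc n)
  define \<nu> where "\<nu> = density M (\<lambda>x. ennreal (h x))"
  interpret \<nu>: real_distribution \<nu>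
    using assms(4) by (simp add: \<nu>_def)
  let ?g = "\<lambda>u. f u * ennreal (exp (t * u))"
  have "walk_nn \<nu> (Suc n) f s = (\<integral>\<^sup>+x. ennreal (h x) * walk_nn \<nu> n f (s + x) \<partial>M)"
    unfolding walk_nn.simps by (subst (1) \<nu>_def, subst nn_integral_density) auto
  also have "\<dots> \<le> (\<integral>\<^sup>+x. ennreal (C ^ Suc n * exp (- (t * s))) * walk_nn M n ?g (s + x) \<partial>M)"
  proof (intro nn_integral_mono)
    fix x
    have "ennreal (h x) * walk_nn \<nu> n f (s + x) \<le>
        ennreal (C * exp (t * x)) * (ennreal (C ^ n * exp (- (t * (s + x)))) * walk_nn M n ?g (s + x))"
      using h Suc unfolding \<nu>_def by (intro mult_mono ennreal_leI) auto
    also have "\<dots> = ennreal ((C * exp (t * x)) * (C ^ n * exp (- (t * (s + x))))) * walk_nn M n ?g (s + x)"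
      using C by (subst ennreal_mult'') (auto simp: mult.assoc)
    also have "(C * exp (t * x)) * (C ^ n * exp (- (t * (s + x)))) =
        C ^ Suc n * (exp (t * x) * exp (- (t * (s + x))))"
      by simp
    also have "exp (t * x) * exp (- (t * (s + x))) = exp (- (t * s))"
      unfolding exp_add[symmetric] by (simp add: algebra_simps)
    finally show "ennreal (h x) * walk_nn \<nu> n f (s + x) \<le>
        ennreal (C ^ Suc n * exp (- (t * s))) * walk_nn M n ?g (s + x)" .
  qed
  also have "\<dots> = ennreal (C ^ Suc n * exp (- (t * s))) * walk_nn M (Suc n) ?g s"
    by (simp add: nn_integral_cmult)
  finally show ?case
    by (simp add: \<nu>_def)
qed

lemma walk_nn_second_moment:
  assumes int: "integrable M (\<lambda>x. x)" "integrable M (\<lambda>x. (x - a)\<^sup>2)" and a: "expectation (\<lambda>x. x) = a"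
  shows "walk_nn M n (\<lambda>u. ennreal ((u - c)\<^sup>2)) s =
    ennreal ((s + real n * a - c)\<^sup>2 + real n * expectation (\<lambda>x. (x - a)\<^sup>2))"
proof (induction n arbitrary: s)
  case (Suc n)
  define A where "A = s + real (Suc n) * a - c"
  define V where "V = expectation (\<lambda>x. (x - a)\<^sup>2)"
  have V: "0 \<le> V"
    by (simp add: V_def)
  have eq: "(s + x + real n * a - c)\<^sup>2 + real n * V = (A\<^sup>2 + real n * V) + (2 * A * (x - a) + (x - a)\<^sup>2)" for x
    by (simp add: A_def power2_eq_square algebra_simps)
  have "walk_nn M (Suc n) (\<lambda>u. ennreal ((u - c)\<^sup>2)) s =
      (\<integral>\<^sup>+x. ennreal ((s + x + real n * a - c)\<^sup>2 + real n * V) \<partial>M)"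
    by (simp add: Suc V_def)
  also have "\<dots> = ennreal (expectation (\<lambda>x. (s + x + real n * a - c)\<^sup>2 + real n * V))"
  proof (rule nn_integral_eq_integral)
    show "integrable M (\<lambda>x. (s + x + real n * a - c)\<^sup>2 + real n * V)"
      unfolding eq using int by simp
  qed (use V in auto)
  also have "expectation (\<lambda>x. (s + x + real n * a - c)\<^sup>2 + real n * V) =
      expectation (\<lambda>x. A\<^sup>2 + real n * V) + (2 * A * (expectation (\<lambda>x. x) - expectation (\<lambda>x. a)) + V)"
    unfolding eq using int by (simp add: V_def)
  also have "\<dots> = A\<^sup>2 + real n * V + V"
    using a prob_space by simp
  finally show ?case
    by (simp add: A_def V_def algebra_simps)
qed simp

text \<open>Chebyshev's inequality: the complement has probability at most
  \<open>V / (n * \<eta>\<^sup>2)\<close>, which is at most 1/2 once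
  \<open>n \<ge> 2 * V / \<eta>\<^sup>2\<close>.\<close>

lemma walk_nn_weak_law:
  assumes int: "integrable M (\<lambda>x. x)" "integrable M (\<lambda>x. (x - a)\<^sup>2)" and a: "expectation (\<lambda>x. x) = a"
    and \<eta>: "0 < \<eta>"
  shows "eventually (\<lambda>n. ennreal (1 / 2) \<le> walk_nn M n (indicator {u. \<bar>u - real n * a\<bar> \<le> real n * \<eta>}) 0) sequentially"
proof -
  define V where "V = expectation (\<lambda>x. (x - a)\<^sup>2)"
  have V: "0 \<le> V"
    by (simp add: V_def)
  have "eventually (\<lambda>n. real n \<ge> 2 * V / \<eta>\<^sup>2) sequentially"
    using filterlim_real_sequentially by (auto simp: filterlim_at_top)
  then show ?thesis
    using eventually_gt_at_top[of 0]
  proof eventually_elim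
    case (elim n)
    let ?f = "indicator {u. \<bar>u - real n * a\<bar> \<le> real n * \<eta>} :: real \<Rightarrow> ennreal"
    define r where "r = real n * \<eta>"
    let ?c = "1 / r\<^sup>2"
    have r: "0 < r"
      using elim \<eta> by (simp add: r_def)
    have "1 = walk_nn M n (\<lambda>_. 1) 0"
      by (simp add: walk_nn_const)
    also have "\<dots> \<le> walk_nn M n (\<lambda>u. ?f u + ennreal ?c * ennreal ((u - real n * a)\<^sup>2)) 0"
    proof (intro walk_nn_mono)
      fix u
      show "1 \<le> ?f u + ennreal ?c * ennreal ((u - real n * a)\<^sup>2)"
      proof (cases "\<bar>u - real n * a\<bar> \<le> r")
        case False
        define v where "v = \<bar>u - real n * a\<bar>"
        have "r\<^sup>2 \<le> v\<^sup>2"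
          using r False by (intro power_mono) (auto simp: v_def)
        then have "1 \<le> ?c * v\<^sup>2"
          using r by (simp add: le_divide_eq)
        then have "1 \<le> ?c * (u - real n * a)\<^sup>2"
          by (simp add: v_def)
        then have "ennreal 1 \<le> ennreal (?c * (u - real n * a)\<^sup>2)"
          by (rule ennreal_leI)
        also have "\<dots> = ennreal ?c * ennreal ((u - real n * a)\<^sup>2)"
          by (rule ennreal_mult) auto
        finally show ?thesis
          by (simp add: add_increasing)
      qed (simp add: r_def)
    qed
    also have "\<dots> = walk_nn M n ?f 0 + ennreal ?c * ennreal (real n * V)"
      by (subst walk_nn_add) (auto simp: walk_nn_cmult walk_nn_second_moment[OF int a] V_def)
    also have "\<dots> = walk_nn M n ?f 0 + ennreal (?c * (real n * V))"
      using V by (subst (2) ennreal_mult) auto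
    also have "?c * (real n * V) \<le> 1 / 2"
      using elim \<eta> r by (simp add: r_def field_simps power2_eq_square)
    finally have "1 \<le> walk_nn M n ?f 0 + ennreal (1 / 2)"
      by (simp add: add_left_mono ennreal_leI)
    then have *: "ennreal 1 \<le> walk_nn M n ?f 0 + ennreal (1 / 2)"
      by (simp only: ennreal_1)
    show ?case
    proof (cases "walk_nn M n ?f 0" rule: ennreal_cases)
      case (real w)
      have "ennreal 1 \<le> ennreal (w + 1 / 2)"
        using * real by (subst ennreal_plus) auto
      then have "1 \<le> w + 1 / 2"
        using real(1) by (subst (asm) ennreal_le_iff) auto
      then show ?thesis
        unfolding real(2) by (intro ennreal_leI) simp
    qed simp
  qed
qed

section \<open>Truncated generating functions and exponential tilting\<close>

text \<open>Not normalised by the mass of the window: so its value at \<open>t = 0\<close> is at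
  most 1, and it increases in \<open>R\<close> to exp(-ta)\<psi>(t). With the centring at
  \<open>a\<close>, a stationary point is a tilt with mean \<open>a\<close>.\<close>

definition trunc_mgf :: "real \<Rightarrow> nat \<Rightarrow> real \<Rightarrow> real" where
  "trunc_mgf a R t = expectation (\<lambda>x. indicator {x. \<bar>x - a\<bar> \<le> real R} x * exp (t * (x - a)))"

lemma trunc_exp_bounded:
  "indicator {x. \<bar>x - a\<bar> \<le> real R} x * exp (t * (x - a)) \<le> exp (\<bar>t\<bar> * real R)"
proof (cases "\<bar>x - a\<bar> \<le> real R")
  case True
  have "t * (x - a) \<le> \<bar>t\<bar> * \<bar>x - a\<bar>"
    by (metis abs_ge_self abs_mult)
  also have "\<dots> \<le> \<bar>t\<bar> * real R"
    using True by (intro mult_left_mono) auto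
  finally show ?thesis
    using True by simp
qed simp

lemma integrable_trunc_exp:
  "integrable M (\<lambda>x. indicator {x. \<bar>x - a\<bar> \<le> real R} x * exp (t * (x - a)))"
  using trunc_exp_bounded by (intro integrable_const_bound[where B = "exp (\<bar>t\<bar> * real R)"]) auto

lemma integrable_trunc_exp_mult:
  assumes [measurable]: "g \<in> borel_measurable borel" and "\<And>x. \<bar>x - a\<bar> \<le> real R \<Longrightarrow> \<bar>g x\<bar> \<le> B"
  shows "integrable M (\<lambda>x. indicator {x. \<bar>x - a\<bar> \<le> real R} x * exp (t * (x - a)) * g x)"
proof (intro integrable_const_bound[where B = "exp (\<bar>t\<bar> * real R) * B"] AE_I2)
  fix x
  show "norm (indicator {x. \<bar>x - a\<bar> \<le> real R} x * exp (t * (x - a)) * g x) \<le> exp (\<bar>t\<bar> * real R) * B"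
  proof (cases "\<bar>x - a\<bar> \<le> real R")
    case True
    then show ?thesis
      using assms(2)[OF True] trunc_exp_bounded[of a R x t] by (auto simp: abs_mult intro!: mult_mono)
  next
    case False
    have "0 \<le> B"
      using assms(2)[of a] abs_ge_zero order_trans by fastforce
    then show ?thesis
      using False by simp
  qed
qed measurable

lemma isCont_trunc_mgf: "isCont (trunc_mgf a R) t"
proof (rule continuous_within_sequentiallyI)
  fix u assume u: "u \<longlonglongrightarrow> t"
  then obtain T where T: "\<And>n. \<bar>u n\<bar> \<le> T"
    by (metis convergentI convergent_imp_Bseq BseqE real_norm_def)
  show "(\<lambda>n. trunc_mgf a R (u n)) \<longlonglongrightarrow> trunc_mgf a R t"
    unfolding trunc_mgf_def
  proof (rule integral_dominated_convergence[where w = "\<lambda>_. exp (T * real R)"])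
    show "AE x in M. (\<lambda>n. indicator {x. \<bar>x - a\<bar> \<le> real R} x * exp (u n * (x - a)))
        \<longlonglongrightarrow> indicator {x. \<bar>x - a\<bar> \<le> real R} x * exp (t * (x - a))"
      by (intro AE_I2 tendsto_intros u)
    show "AE x in M. norm (indicator {x. \<bar>x - a\<bar> \<le> real R} x * exp (u n * (x - a))) \<le> exp (T * real R)" for n
    proof (intro AE_I2)
      fix x
      have "norm (indicator {x. \<bar>x - a\<bar> \<le> real R} x * exp (u n * (x - a))) \<le> exp (\<bar>u n\<bar> * real R)"
        using trunc_exp_bounded[of a R x "u n"] by simp
      also have "\<dots> \<le> exp (T * real R)"
        using T[of n] by (simp add: mult_right_mono)
      finally show "norm (indicator {x. \<bar>x - a\<bar> \<le> real R} x * exp (u n * (x - a))) \<le> exp (T * real R)" .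
    qed
  qed auto
qed

lemma trunc_mgf_mono: "R \<le> R' \<Longrightarrow> trunc_mgf a R t \<le> trunc_mgf a R' t"
  unfolding trunc_mgf_def
  by (intro integral_mono integrable_trunc_exp) (auto simp: indicator_def)

lemma trunc_mgf_nn_integral:
  "ennreal (trunc_mgf a R t) = (\<integral>\<^sup>+x. indicator {x. \<bar>x - a\<bar> \<le> real R} x * ennreal (exp (t * (x - a))) \<partial>M)"
proof -
  have "ennreal (trunc_mgf a R t) = (\<integral>\<^sup>+x. ennreal (indicator {x. \<bar>x - a\<bar> \<le> real R} x * exp (t * (x - a))) \<partial>M)"
    unfolding trunc_mgf_def by (subst nn_integral_eq_integral) (auto intro: integrable_trunc_exp)
  also have "\<dots> = (\<integral>\<^sup>+x. indicator {x. \<bar>x - a\<bar> \<le> real R} x * ennreal (exp (t * (x - a))) \<partial>M)"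
    by (intro nn_integral_cong) (auto simp: indicator_def)
  finally show ?thesis .
qed

lemma SUP_trunc_mgf: "(SUP R. ennreal (trunc_mgf a R t)) = (\<integral>\<^sup>+x. ennreal (exp (t * (x - a))) \<partial>M)"
proof -
  have "(\<integral>\<^sup>+x. ennreal (exp (t * (x - a))) \<partial>M) =
      (\<integral>\<^sup>+x. (SUP R. indicator {x. \<bar>x - a\<bar> \<le> real R} x * ennreal (exp (t * (x - a)))) \<partial>M)"
  proof (intro nn_integral_cong antisym)
    fix x
    obtain R :: nat where "\<bar>x - a\<bar> \<le> real R"
      using real_arch_simple by blast
    then show "ennreal (exp (t * (x - a))) \<le> (SUP R. indicator {x. \<bar>x - a\<bar> \<le> real R} x * ennreal (exp (t * (x - a))))"
      by (intro SUP_upper2[of R]) auto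
    show "(SUP R. indicator {x. \<bar>x - a\<bar> \<le> real R} x * ennreal (exp (t * (x - a)))) \<le> ennreal (exp (t * (x - a)))"
      by (intro SUP_least) (auto simp: indicator_def)
  qed
  also have "\<dots> = (SUP R. \<integral>\<^sup>+x. indicator {x. \<bar>x - a\<bar> \<le> real R} x * ennreal (exp (t * (x - a))) \<partial>M)"
    by (intro nn_integral_monotone_convergence_SUP)
      (auto simp: incseq_def le_fun_def indicator_def)
  finally show ?thesis
    by (simp add: trunc_mgf_nn_integral)
qed

text \<open>First-order condition at a minimum, without differentiating under the integral.\<close>

lemma trunc_mgf_min_imp_mean_zero:
  assumes "0 < \<epsilon>" and min: "\<And>h. \<bar>h\<bar> \<le> \<epsilon> \<Longrightarrow> trunc_mgf a R t \<le> trunc_mgf a R (t + h)"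
  shows "expectation (\<lambda>x. indicator {x. \<bar>x - a\<bar> \<le> real R} x * exp (t * (x - a)) * (x - a)) = 0"
proof (rule ccontr)
  let ?g = "\<lambda>x. indicator {x. \<bar>x - a\<bar> \<le> real R} x * exp (t * (x - a))"
  define D where "D = expectation (\<lambda>x. ?g x * (x - a))"
  assume "expectation (\<lambda>x. ?g x * (x - a)) \<noteq> 0"
  then have D: "D \<noteq> 0"
    by (simp add: D_def)
  have int1: "integrable M (\<lambda>x. ?g x * (x - a))"
    by (rule integrable_trunc_exp_mult) auto
  have taylor: "trunc_mgf a R (t + h) \<le> trunc_mgf a R t + h * D + h\<^sup>2 * (real R)\<^sup>2 * trunc_mgf a R t"
    if h: "\<bar>h\<bar> * real R \<le> 1" for h
  proof -
    have "trunc_mgf a R (t + h) \<le> expectation (\<lambda>x. ?g x + h * (?g x * (x - a)) + h\<^sup>2 * (real R)\<^sup>2 * ?g x)"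
      unfolding trunc_mgf_def
    proof (intro integral_mono)
      fix x
      show "indicator {x. \<bar>x - a\<bar> \<le> real R} x * exp ((t + h) * (x - a)) \<le>
          ?g x + h * (?g x * (x - a)) + h\<^sup>2 * (real R)\<^sup>2 * ?g x"
      proof (cases "\<bar>x - a\<bar> \<le> real R")
        case True
        have "\<bar>h * (x - a)\<bar> \<le> \<bar>h\<bar> * real R"
          using True by (simp add: abs_mult mult_left_mono)
        then have "exp (h * (x - a)) \<le> 1 + h * (x - a) + (h * (x - a))\<^sup>2"
          using h by (intro exp_le_quadratic) linarith
        also have "(h * (x - a))\<^sup>2 \<le> h\<^sup>2 * (real R)\<^sup>2"
          unfolding power_mult_distrib using True by (intro mult_left_mono abs_le_square_iff[THEN iffD1]) auto
        finally have "exp (t * (x - a)) * exp (h * (x - a)) \<le>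
            exp (t * (x - a)) * (1 + h * (x - a) + h\<^sup>2 * (real R)\<^sup>2)"
          by simp
        moreover have "exp ((t + h) * (x - a)) = exp (t * (x - a)) * exp (h * (x - a))"
          by (simp add: exp_add[symmetric] ring_distribs)
        ultimately show ?thesis
          using True by (simp add: ring_distribs mult_ac)
      qed simp
    qed (use int1 integrable_trunc_exp in auto)
    also have "\<dots> = trunc_mgf a R t + h * D + h\<^sup>2 * (real R)\<^sup>2 * trunc_mgf a R t"
      unfolding trunc_mgf_def D_def using int1 integrable_trunc_exp by simp
    finally show ?thesis .
  qed
  define C where "C = (real R)\<^sup>2 * trunc_mgf a R t"
  have C: "0 \<le> C"
    unfolding C_def trunc_mgf_def by (intro mult_nonneg_nonneg integral_nonneg_AE) auto
  \<comment> \<open>The three bounds give local minimality, the range of the Taylor estimate, and a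
    linear gain \<open>e * \<bar>D\<bar>\<close> larger than the quadratic loss
    \<open>e\<^sup>2 * C\<close>. The step \<open>h\<close> then goes against the sign of
    \<open>D\<close>.\<close>
  define e where "e = min \<epsilon> (min (1 / (real R + 1)) (\<bar>D\<bar> / (2 * (C + 1))))"
  have e: "0 < e" "e \<le> \<epsilon>" "e \<le> 1 / (real R + 1)" "e \<le> \<bar>D\<bar> / (2 * (C + 1))"
    using assms(1) D C by (auto simp: e_def)
  define h where "h = - e * sgn D"
  have abs_h: "\<bar>h\<bar> = e"
    using D e by (simp add: h_def abs_mult)
  have "e * real R \<le> 1 / (real R + 1) * real R"
    using e by (intro mult_right_mono) auto
  also have "\<dots> \<le> 1"
    by (simp add: field_simps)
  finally have "trunc_mgf a R (t + h) \<le> trunc_mgf a R t + h * D + h\<^sup>2 * C"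
    using taylor[of h] by (simp add: abs_h C_def mult.assoc)
  moreover have "trunc_mgf a R t \<le> trunc_mgf a R (t + h)"
    using e by (intro min) (simp add: abs_h)
  moreover have "h * D = - (e * \<bar>D\<bar>)"
    by (simp add: h_def abs_sgn mult.assoc mult.commute[of "sgn D"])
  moreover have "h\<^sup>2 = e\<^sup>2"
    using abs_h by (metis power2_abs)
  then have "h\<^sup>2 * C = e * (e * C)"
    by (simp add: power2_eq_square)
  ultimately have "e * \<bar>D\<bar> \<le> e * (e * C)"
    by linarith
  then have "\<bar>D\<bar> \<le> e * C"
    using e(1) by (rule mult_left_le_imp_le)
  also have "\<dots> \<le> \<bar>D\<bar> / (2 * (C + 1)) * C"
    using e C by (intro mult_right_mono) auto
  also have "\<dots> = \<bar>D\<bar> * (C / (2 * (C + 1)))"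
    by simp
  also have "\<dots> < \<bar>D\<bar> * 1"
    using C D by (intro mult_strict_left_mono) (auto simp: divide_less_eq)
  finally show False
    by simp
qed

text \<open>A set on one side of \<open>a\<close> is a countable union of such bands. A band away
  from \<open>a\<close> forces exponential growth of the generating function, and a bounded one
  survives truncation; \<open>s\<close> is 1 or -1 according to the side.\<close>

lemma exists_mass_away:
  assumes "0 < prob {x. 0 < s * (x - a)}"
  shows "\<exists>n::nat. 0 < prob {x. 1 / real (Suc n) \<le> s * (x - a) \<and> s * (x - a) \<le> real n}"
proof (rule ccontr)
  define A where "A n = {x. 1 / real (Suc n) \<le> s * (x - a) \<and> s * (x - a) \<le> real n}" for n :: nat
  assume "\<not> ?thesis"
  then have "emeasure M (A n) = 0" for n
    using measure_nonneg[of M "A n"] by (simp add: emeasure_eq_measure A_def not_less antisym)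
  moreover have A: "A n \<in> events" for n
    unfolding A_def by measurable
  ultimately have "emeasure M (\<Union>n. A n) = 0"
    by (intro emeasure_UN_eq_0) auto
  also have "(\<Union>n. A n) = {x. 0 < s * (x - a)}"
  proof (intro set_eqI iffI)
    fix x assume "x \<in> (\<Union>n. A n)"
    then obtain n where "1 / real (Suc n) \<le> s * (x - a)"
      by (auto simp: A_def)
    moreover have "0 < 1 / real (Suc n)"
      by simp
    ultimately show "x \<in> {x. 0 < s * (x - a)}"
      by (simp only: mem_Collect_eq)
  next
    fix x assume "x \<in> {x. 0 < s * (x - a)}"
    then have pos: "0 < s * (x - a)"
      by simp
    obtain n1 where n1: "1 / real (Suc n1) < s * (x - a)"
      using nat_approx_posE[OF pos] by blast
    obtain n2 :: nat where n2: "s * (x - a) \<le> real n2"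
      using real_arch_simple by blast
    have "1 / real (Suc (max n1 n2)) \<le> 1 / real (Suc n1)"
      by (intro divide_left_mono) auto
    then have "x \<in> A (max n1 n2)"
      using n1 n2 unfolding A_def by auto
    then show "x \<in> (\<Union>n. A n)"
      by blast
  qed
  finally show False
    using assms by (simp add: emeasure_eq_measure)
qed

lemma trunc_mgf_ge:
  assumes "s = 1 \<or> s = - 1" "n \<le> R" "0 \<le> s * t"
  shows "prob {x. 1 / real (Suc n) \<le> s * (x - a) \<and> s * (x - a) \<le> real n} * exp (\<bar>t\<bar> / real (Suc n)) \<le>
    trunc_mgf a R t"
proof -
  let ?A = "{x. 1 / real (Suc n) \<le> s * (x - a) \<and> s * (x - a) \<le> real n}"
  have "prob ?A * exp (\<bar>t\<bar> / real (Suc n)) = expectation (\<lambda>x. indicator ?A x * exp (\<bar>t\<bar> / real (Suc n)))"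
    by simp
  also have "\<dots> \<le> trunc_mgf a R t"
    unfolding trunc_mgf_def
  proof (intro integral_mono integrable_trunc_exp)
    show "integrable M (\<lambda>x. indicator ?A x * exp (\<bar>t\<bar> / real (Suc n)))"
      by (intro integrable_mult_left integrable_real_indicator) (auto simp: emeasure_eq_measure)
    fix x
    show "indicator ?A x * exp (\<bar>t\<bar> / real (Suc n)) \<le> indicator {x. \<bar>x - a\<bar> \<le> real R} x * exp (t * (x - a))"
    proof (cases "x \<in> ?A")
      case True
      then have x: "1 / real (Suc n) \<le> s * (x - a)" "s * (x - a) \<le> real n"
        by auto
      have "0 < 1 / real (Suc n)"
        by simp
      then have "0 < s * (x - a)"
        using x(1) by (rule less_le_trans)
      with x(2) assms(1,2) have "\<bar>x - a\<bar> \<le> real R"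
        by (auto simp: abs_if split: if_splits)
      moreover have "\<bar>t\<bar> * (1 / real (Suc n)) \<le> \<bar>t\<bar> * (s * (x - a))"
        using x by (intro mult_left_mono) auto
      moreover have "\<bar>t\<bar> * (s * (x - a)) = t * (x - a)"
        using assms(1,3) by auto
      ultimately show ?thesis
        using True by simp
    qed simp
  qed
  finally show ?thesis .
qed

text \<open>A Dini-type compactness argument. Points of the interval that are bad for larger and
  larger \<open>R\<close> accumulate at some \<open>l\<close>; by monotonicity in \<open>R\<close>
  and continuity, \<open>l\<close> is bad for every \<open>R\<close>, against
  \<open>SUP_trunc_mgf\<close>.\<close>

lemma exists_trunc_mgf_gt:
  assumes \<beta>: "\<And>t. ennreal \<beta> \<le> (\<integral>\<^sup>+x. ennreal (exp (t * (x - a))) \<partial>M)" and \<gamma>: "0 < \<gamma>" "\<gamma> < \<beta>"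
  shows "\<exists>R\<ge>n. \<forall>t\<in>{- T..T}. \<gamma> < trunc_mgf a R t"
proof (rule ccontr)
  assume "\<not> ?thesis"
  then have "\<forall>R. \<exists>t. n \<le> R \<longrightarrow> t \<in> {- T..T} \<and> trunc_mgf a R t \<le> \<gamma>"
    by (meson not_less)
  then obtain t where t: "\<And>R. n \<le> R \<Longrightarrow> t R \<in> {- T..T} \<and> trunc_mgf a R (t R) \<le> \<gamma>"
    by metis
  have "seq_compact {- T..T}"
    using compact_Icc[of "- T" T] by (simp add: compact_eq_seq_compact_metric)
  moreover have "\<forall>k. t (n + k) \<in> {- T..T}"
    using t by simp
  ultimately obtain l r where "strict_mono r" "((\<lambda>k. t (n + k)) \<circ> r) \<longlonglongrightarrow> l"
    by (rule seq_compactE)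
  then have l: "strict_mono r" "(\<lambda>k. t (n + r k)) \<longlonglongrightarrow> l"
    by (auto simp: comp_def)
  have "trunc_mgf a R l \<le> \<gamma>" for R
  proof (rule tendsto_upperbound)
    show "(\<lambda>k. trunc_mgf a R (t (n + r k))) \<longlonglongrightarrow> trunc_mgf a R l"
      by (rule isCont_tendsto_compose[OF isCont_trunc_mgf l(2)])
    show "eventually (\<lambda>k. trunc_mgf a R (t (n + r k)) \<le> \<gamma>) sequentially"
      using eventually_ge_at_top[of R]
    proof eventually_elim
      case (elim k)
      have "R \<le> n + r k"
        using elim seq_suble[OF l(1), of k] by linarith
      then have "trunc_mgf a R (t (n + r k)) \<le> trunc_mgf a (n + r k) (t (n + r k))"
        by (rule trunc_mgf_mono)
      then show ?case
        using t[of "n + r k"] by simp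
    qed
  qed simp
  then have "(SUP R. ennreal (trunc_mgf a R l)) \<le> ennreal \<gamma>"
    by (intro SUP_least ennreal_leI)
  then have "ennreal \<beta> \<le> ennreal \<gamma>"
    using \<beta>[of l] by (simp add: SUP_trunc_mgf)
  then show False
    using \<gamma> by (simp add: ennreal_le_iff)
qed

text \<open>The order of choices matters. First \<open>T\<close> is fixed so that the value exceeds
  1 at both ends for all \<open>R\<close> containing the two bands; only then is \<open>R\<close>
  taken large enough for the bound \<open>\<gamma>\<close> on the whole interval. As the value at 0
  is at most 1, the minimum over the interval is interior.\<close>

lemma exists_trunc_mgf_min:
  assumes \<beta>: "\<And>t. ennreal \<beta> \<le> (\<integral>\<^sup>+x. ennreal (exp (t * (x - a))) \<partial>M)" and \<gamma>: "0 < \<gamma>" "\<gamma> < \<beta>"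
    and "0 < prob {x. a < x}" "0 < prob {x. x < a}"
  obtains R t \<epsilon> where "\<gamma> < trunc_mgf a R t" "0 < \<epsilon>"
    "\<And>h. \<bar>h\<bar> \<le> \<epsilon> \<Longrightarrow> trunc_mgf a R t \<le> trunc_mgf a R (t + h)"
proof -
  obtain n1 where n1: "0 < prob {x. 1 / real (Suc n1) \<le> 1 * (x - a) \<and> 1 * (x - a) \<le> real n1}"
    using exists_mass_away[of 1 a] assms(4) by auto
  obtain n2 where n2: "0 < prob {x. 1 / real (Suc n2) \<le> (- 1) * (x - a) \<and> (- 1) * (x - a) \<le> real n2}"
    using exists_mass_away[of "- 1" a] assms(5) by auto
  define q1 where "q1 = prob {x. 1 / real (Suc n1) \<le> 1 * (x - a) \<and> 1 * (x - a) \<le> real n1}"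
  define q2 where "q2 = prob {x. 1 / real (Suc n2) \<le> (- 1) * (x - a) \<and> (- 1) * (x - a) \<le> real n2}"
  have q: "0 < q1" "0 < q2"
    using n1 n2 by (auto simp: q1_def q2_def)
  have large: "\<exists>T>0. 1 < q * exp (T / real (Suc n))" if "0 < q" for q and n :: nat
  proof -
    define T where "T = real (Suc n) * (\<bar>ln q\<bar> + 1)"
    have "1 = q * exp (- ln q)"
      using that by (simp add: exp_minus)
    also have "\<dots> < q * exp (\<bar>ln q\<bar> + 1)"
      using that by (intro mult_strict_left_mono) auto
    also have "\<bar>ln q\<bar> + 1 = T / real (Suc n)"
      by (simp add: T_def)
    finally have "1 < q * exp (T / real (Suc n))" .
    moreover have "0 < T"
      unfolding T_def by (intro mult_pos_pos) auto
    ultimately show ?thesis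
      by blast
  qed
  obtain T1 where T1: "0 < T1" "1 < q1 * exp (T1 / real (Suc n1))"
    using large q by blast
  obtain T2 where T2: "0 < T2" "1 < q2 * exp (T2 / real (Suc n2))"
    using large q by blast
  define T where "T = max T1 T2"
  obtain R where R: "max n1 n2 \<le> R" "\<And>t. t \<in> {- T..T} \<Longrightarrow> \<gamma> < trunc_mgf a R t"
    using exists_trunc_mgf_gt[OF \<beta> \<gamma>] by blast
  have "continuous_on {- T..T} (trunc_mgf a R)"
    using isCont_trunc_mgf by (intro continuous_at_imp_continuous_on) auto
  moreover have "{- T..T} \<noteq> {}"
    using T1 by (auto simp: T_def)
  ultimately obtain t where t: "t \<in> {- T..T}" "\<And>u. u \<in> {- T..T} \<Longrightarrow> trunc_mgf a R t \<le> trunc_mgf a R u"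
    using continuous_attains_inf[OF compact_Icc] by metis
  have "trunc_mgf a R 0 \<le> 1"
    unfolding trunc_mgf_def by (simp add: prob_le_1)
  then have le1: "trunc_mgf a R t \<le> 1"
    using t(2)[of 0] T1 by (fastforce simp: T_def)
  have "1 < trunc_mgf a R T"
  proof -
    have "q1 * exp (T1 / real (Suc n1)) \<le> q1 * exp (\<bar>T\<bar> / real (Suc n1))"
      using q T1 by (intro mult_left_mono) (auto simp: T_def divide_right_mono)
    also have "\<dots> \<le> trunc_mgf a R T"
      unfolding q1_def using R T1 by (intro trunc_mgf_ge) (auto simp: T_def)
    finally show ?thesis
      using T1 by simp
  qed
  moreover have "1 < trunc_mgf a R (- T)"
  proof -
    have "q2 * exp (T2 / real (Suc n2)) \<le> q2 * exp (\<bar>- T\<bar> / real (Suc n2))"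
      using q T2 by (intro mult_left_mono) (auto simp: T_def divide_right_mono)
    also have "\<dots> \<le> trunc_mgf a R (- T)"
      unfolding q2_def using R T1 by (intro trunc_mgf_ge) (auto simp: T_def)
    finally show ?thesis
      using T2 by simp
  qed
  ultimately have "- T < t" "t < T"
    using t(1) le1 by (auto simp: less_le)
  then have "0 < min (T - t) (t + T)"
    by simp
  moreover have "trunc_mgf a R t \<le> trunc_mgf a R (t + h)" if "\<bar>h\<bar> \<le> min (T - t) (t + T)" for h
    using that by (intro t(2)) auto
  ultimately show ?thesis
    using that R(2)[OF t(1)] by blast
qed

text \<open>\<open>\<beta>\<close> plays the role of exp(-I(a)). Under the law tilted at the
  minimiser the walk has drift \<open>a\<close>, so half of its mass lies within
  \<open>n * \<eta>\<close> of \<open>n * a\<close>. Undoing the tilt there leaves at least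
  \<open>\<phi> ^ n * exp (- \<bar>t\<bar> * n * \<eta>) / 2\<close>, and
  \<open>\<gamma> < \<phi>\<close> pays for both losses.\<close>

lemma cramer_lower_bound:
  assumes \<beta>: "\<And>t. ennreal \<beta> \<le> (\<integral>\<^sup>+x. ennreal (exp (t * (x - a))) \<partial>M)" and \<gamma>: "0 < \<gamma>" "\<gamma> < \<beta>"
    and "0 < prob {x. a < x}" "0 < prob {x. x < a}" and \<delta>: "0 < \<delta>"
  shows "eventually (\<lambda>n. ennreal (\<gamma> ^ n) \<le> walk_nn M n (indicator {u. real n * (a - \<delta>) \<le> u}) 0) sequentially"
proof -
  obtain R t \<epsilon> where \<phi>_gt: "\<gamma> < trunc_mgf a R t" and "0 < \<epsilon>"
    and "\<And>h. \<bar>h\<bar> \<le> \<epsilon> \<Longrightarrow> trunc_mgf a R t \<le> trunc_mgf a R (t + h)"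
    using exists_trunc_mgf_min[OF assms(1-5)] by metis
  note mean0 = trunc_mgf_min_imp_mean_zero[OF this(2,3)]
  define \<phi> where "\<phi> = trunc_mgf a R t"
  have \<phi>: "0 < \<phi>" "\<gamma> < \<phi>"
    using \<phi>_gt \<gamma> by (auto simp: \<phi>_def)
  let ?g = "\<lambda>x. indicator {x. \<bar>x - a\<bar> \<le> real R} x * exp (t * (x - a))"
  define h where "h x = ?g x / \<phi>" for x
  have h_nonneg: "0 \<le> h x" for x
    using \<phi> by (simp add: h_def)
  have h_meas [measurable]: "h \<in> borel_measurable borel"
    unfolding h_def by measurable
  define \<nu> where "\<nu> = density M (\<lambda>x. ennreal (h x))"
  have int_h: "integrable M h" "expectation h = 1"
    using integrable_trunc_exp[of a R t] \<phi> by (auto simp: h_def[abs_def] \<phi>_def trunc_mgf_def)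
  have "emeasure \<nu> (space \<nu>) = (\<integral>\<^sup>+x. ennreal (h x) \<partial>M)"
    unfolding \<nu>_def by (simp add: emeasure_density)
  also have "\<dots> = 1"
    using int_h h_nonneg by (subst nn_integral_eq_integral) auto
  finally have "prob_space \<nu>"
    by (rule prob_spaceI)
  then have real_\<nu>: "real_distribution \<nu>"
    by (simp add: real_distribution_def real_distribution_axioms_def \<nu>_def)
  interpret \<nu>: real_distribution \<nu>
    by (rule real_\<nu>)
  have int_\<nu>: "integrable \<nu> f" if [measurable]: "f \<in> borel_measurable borel"
    and "\<And>x. \<bar>x - a\<bar> \<le> real R \<Longrightarrow> \<bar>f x\<bar> \<le> B" for f :: "real \<Rightarrow> real" and B
  proof -
    have "integrable M (\<lambda>x. ?g x * f x / \<phi>)"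
      using that by (intro integrable_divide integrable_trunc_exp_mult) auto
    then show ?thesis
      unfolding \<nu>_def using h_nonneg by (subst integrable_density) (auto simp: h_def)
  qed
  have int1: "integrable \<nu> (\<lambda>x. x)"
    by (rule int_\<nu>[of _ "\<bar>a\<bar> + real R"]) auto
  have int2: "integrable \<nu> (\<lambda>x. (x - a)\<^sup>2)"
  proof (rule int_\<nu>[of _ "(real R)\<^sup>2"])
    fix x assume "\<bar>x - a\<bar> \<le> real R"
    then have "\<bar>x - a\<bar>\<^sup>2 \<le> (real R)\<^sup>2"
      by (intro power_mono) auto
    then show "\<bar>(x - a)\<^sup>2\<bar> \<le> (real R)\<^sup>2"
      by simp
  qed auto
  have "\<nu>.expectation (\<lambda>x. x - a) = expectation (\<lambda>x. h x * (x - a))"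
    unfolding \<nu>_def using h_nonneg by (subst integral_density) auto
  also have "\<dots> = expectation (\<lambda>x. ?g x * (x - a)) / \<phi>"
    by (simp add: h_def)
  finally have mean: "\<nu>.expectation (\<lambda>x. x) = a"
    using int1 \<nu>.prob_space by (simp add: mean0)
  \<comment> \<open>Small enough that the window stays above \<open>n * (a - \<delta>)\<close> and
    that the tilt varies on it by less than the ratio of \<open>\<phi>\<close> to
    \<open>\<gamma>\<close> per step; the \<open>+ 1\<close> covers \<open>t = 0\<close>.\<close>
  define \<eta> where "\<eta> = min \<delta> (ln (\<phi> / \<gamma>) / (\<bar>t\<bar> + 1))"
  have ln_pos: "0 < ln (\<phi> / \<gamma>)"
    using \<gamma> \<phi> by simp
  then have \<eta>: "0 < \<eta>" "\<eta> \<le> \<delta>"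
    using \<delta> by (auto simp: \<eta>_def)
  have "\<bar>t\<bar> * \<eta> < ln (\<phi> / \<gamma>)"
  proof -
    have "\<bar>t\<bar> * \<eta> < (\<bar>t\<bar> + 1) * \<eta>"
      using \<eta> by (simp add: ring_distribs)
    also have "\<dots> \<le> (\<bar>t\<bar> + 1) * (ln (\<phi> / \<gamma>) / (\<bar>t\<bar> + 1))"
      by (intro mult_left_mono) (auto simp: \<eta>_def)
    also have "\<dots> = ln (\<phi> / \<gamma>)"
      by (simp add: add_nonneg_eq_0_iff)
    finally show ?thesis .
  qed
  then have "exp (\<bar>t\<bar> * \<eta>) < exp (ln (\<phi> / \<gamma>))"
    by simp
  then have "exp (\<bar>t\<bar> * \<eta>) < \<phi> / \<gamma>"
    using \<gamma> \<phi> by simp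
  then have "\<gamma> * exp (\<bar>t\<bar> * \<eta>) / \<phi> < 1"
    using \<gamma> \<phi> by (simp add: field_simps)
  moreover define r where "r = \<gamma> * exp (\<bar>t\<bar> * \<eta>) / \<phi>"
  ultimately have r: "0 < r" "r < 1"
    using \<gamma> \<phi> by auto
  then have "(\<lambda>n. r ^ n) \<longlonglongrightarrow> 0"
    by (intro LIMSEQ_realpow_zero) auto
  then have "eventually (\<lambda>n. r ^ n < 1 / 2) sequentially"
    by (rule order_tendstoD) simp
  with \<nu>.walk_nn_weak_law[OF int1 int2 mean \<eta>(1)] show ?thesis
  proof eventually_elim
    case (elim n)
    let ?f = "indicator {u. \<bar>u - real n * a\<bar> \<le> real n * \<eta>} :: real \<Rightarrow> ennreal"
    let ?A = "indicator {u. real n * (a - \<delta>) \<le> u} :: real \<Rightarrow> ennreal"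
    \<comment> \<open>\<open>C\<close> collects the centring and normalisation of one step, and
      \<open>E\<close> bounds \<open>exp (t * u)\<close> on the window.\<close>
    define C where "C = exp (- (t * a)) / \<phi>"
    define E where "E = exp (t * (real n * a) + \<bar>t\<bar> * (real n * \<eta>))"
    have h_le: "h x \<le> C * exp (t * x)" for x
    proof -
      have "exp (t * (x - a)) / \<phi> = C * exp (t * x)"
      proof -
        have "exp (t * (x - a)) = exp (- (t * a)) * exp (t * x)"
          unfolding exp_add[symmetric] by (simp add: algebra_simps)
        then show ?thesis
          by (simp add: C_def)
      qed
      moreover have "h x \<le> exp (t * (x - a)) / \<phi>"
        using \<phi> by (auto simp: h_def indicator_def)
      ultimately show ?thesis
        by simp
    qed
    have C: "0 \<le> C"
      using \<phi> by (simp add: C_def)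
    have "ennreal (1 / 2) \<le> walk_nn \<nu> n ?f 0"
      by (rule elim)
    also have "\<dots> \<le> ennreal (C ^ n) * walk_nn M n (\<lambda>u. ?f u * ennreal (exp (t * u))) 0"
      using walk_nn_density_le[of ?f h C t n 0] h_le real_\<nu> C by (simp add: \<nu>_def)
    also have "\<dots> \<le> ennreal (C ^ n) * walk_nn M n (\<lambda>u. ennreal E * ?A u) 0"
    proof (intro mult_left_mono walk_nn_mono)
      fix u
      show "?f u * ennreal (exp (t * u)) \<le> ennreal E * ?A u"
      proof (cases "\<bar>u - real n * a\<bar> \<le> real n * \<eta>")
        case True
        have "t * (u - real n * a) \<le> \<bar>t\<bar> * \<bar>u - real n * a\<bar>"
          by (metis abs_ge_self abs_mult)
        also have "\<dots> \<le> \<bar>t\<bar> * (real n * \<eta>)"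
          using True by (intro mult_left_mono) auto
        finally have "exp (t * u) \<le> E"
          by (simp add: E_def algebra_simps)
        moreover have "real n * \<eta> \<le> real n * \<delta>"
          using \<eta> by (intro mult_left_mono) auto
        then have "real n * (a - \<delta>) \<le> u"
          using True by (simp add: algebra_simps)
        ultimately show ?thesis
          using True by (simp add: ennreal_leI)
      qed simp
    qed simp
    also have "\<dots> = ennreal (C ^ n * E) * walk_nn M n ?A 0"
      using C by (simp add: walk_nn_cmult ennreal_mult'' mult.assoc E_def)
    finally have half: "ennreal (1 / 2) \<le> ennreal (C ^ n * E) * walk_nn M n ?A 0" .
    have CE: "\<gamma> ^ n * (C ^ n * E) = r ^ n"
    proof -
      have "E = (exp (t * a) * exp (\<bar>t\<bar> * \<eta>)) ^ n"
        unfolding E_def exp_add[symmetric] exp_of_nat_mult[symmetric] by (simp add: algebra_simps)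
      then have "\<gamma> ^ n * (C ^ n * E) = (\<gamma> * (C * (exp (t * a) * exp (\<bar>t\<bar> * \<eta>)))) ^ n"
        by (simp add: power_mult_distrib)
      also have "\<gamma> * (C * (exp (t * a) * exp (\<bar>t\<bar> * \<eta>))) = r"
        by (simp add: C_def r_def exp_minus)
      finally show ?thesis .
    qed
    have CE_pos: "0 < C ^ n * E"
      using \<phi> by (simp add: C_def E_def)
    show ?case
    proof (cases "walk_nn M n ?A 0" rule: ennreal_cases)
      case (real w)
      have "ennreal (1 / 2) \<le> ennreal ((C ^ n * E) * w)"
        using half real CE_pos by (subst ennreal_mult) auto
      then have "1 / 2 \<le> (C ^ n * E) * w"
        using real(1) CE_pos by (subst (asm) ennreal_le_iff) auto
      then have "\<gamma> ^ n * (C ^ n * E) \<le> (C ^ n * E) * w"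
        using elim(2) CE by linarith
      then have "\<gamma> ^ n \<le> w"
        using CE_pos by (metis mult.commute mult_le_cancel_left_pos)
      then show ?thesis
        unfolding real(2) by (rule ennreal_leI)
    qed simp
  qed
qed

section \<open>From random walk estimates to bounds on the maximum\<close>

text \<open>Each generation averages over one step and then multiplies by \<open>m'\<close>. The cap
  \<open>u0\<close> does not interfere during \<open>l\<close> generations, because the walk
  expectation is at most 1 and \<open>m' ^ l * c \<le> u0\<close>.\<close>

lemma brw_cdf_complement_ge_walk:
  assumes h: "\<And>u. 0 \<le> u \<Longrightarrow> u \<le> 1 \<Longrightarrow> m' * min u u0 \<le> 1 - measure_pmf.expectation p (\<lambda>k. (1 - u) ^ k)"
    and m': "1 \<le> m'" and c: "0 < c" "m' ^ l * c \<le> u0"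
    and s: "\<And>y. y < s \<Longrightarrow> c \<le> 1 - brw_cdf p M n y" and "j \<le> l"
  shows "ennreal (m' ^ j * c) * walk_nn M j (indicator {0<..}) (s - y) \<le> ennreal (1 - brw_cdf p M (n + j) y)"
  using \<open>j \<le> l\<close>
proof (induction j arbitrary: y)
  case 0
  then show ?case
    using s[of y] by (auto simp: indicator_def ennreal_leI)
next
  case (Suc j)
  define q where "q = expectation (\<lambda>x. brw_cdf p M (n + j) (y - x))"
  have q: "0 \<le> q" "q \<le> 1"
    using expectation_brw_cdf_bounds by (auto simp: q_def)
  let ?W = "walk_nn M (Suc j) (indicator {0<..}) (s - y)"
  have "?W \<le> walk_nn M (Suc j) (\<lambda>_. 1) (s - y)"
    by (rule walk_nn_mono) (simp add: indicator_def)
  then have W: "?W \<le> 1"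
    by (simp only: walk_nn_const)
  have "m' ^ j * c \<le> m' ^ l * c"
    using Suc.prems m' c by (intro mult_right_mono power_increasing) auto
  then have "m' ^ j * c \<le> u0"
    using c(2) by (rule order_trans)
  moreover have "0 < m' ^ j * c"
    using m' c by simp
  ultimately have mc: "0 < m' ^ j * c" "m' ^ j * c \<le> u0"
    by auto
  have "ennreal (m' ^ j * c) * ?W = (\<integral>\<^sup>+x. ennreal (m' ^ j * c) * walk_nn M j (indicator {0<..}) (s - (y - x)) \<partial>M)"
    by (simp add: nn_integral_cmult algebra_simps)
  also have "\<dots> \<le> (\<integral>\<^sup>+x. ennreal (1 - brw_cdf p M (n + j) (y - x)) \<partial>M)"
    using Suc by (intro nn_integral_mono) auto
  also have "\<dots> = ennreal (expectation (\<lambda>x. 1 - brw_cdf p M (n + j) (y - x)))"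
    using integrable_brw_cdf by (intro nn_integral_eq_integral) (auto simp: brw_cdf_le_1)
  also have "expectation (\<lambda>x. 1 - brw_cdf p M (n + j) (y - x)) = 1 - q"
    using integrable_brw_cdf prob_space by (simp add: q_def)
  finally have le1: "ennreal (m' ^ j * c) * ?W \<le> ennreal (1 - q)" .
  have "ennreal (m' ^ j * c) * ?W \<le> ennreal (m' ^ j * c) * 1"
    using W by (intro mult_left_mono) auto
  also have "\<dots> \<le> ennreal u0"
    using mc by (simp add: ennreal_leI)
  finally have "ennreal (m' ^ j * c) * ?W \<le> ennreal (min (1 - q) u0)"
    using le1 by (simp add: min_def)
  then have "ennreal m' * (ennreal (m' ^ j * c) * ?W) \<le> ennreal m' * ennreal (min (1 - q) u0)"
    by (rule mult_left_mono) simp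
  also have "\<dots> = ennreal (m' * min (1 - q) u0)"
    using m' by (simp add: ennreal_mult')
  also have "\<dots> \<le> ennreal (1 - brw_cdf p M (n + Suc j) y)"
    using h[of "1 - q"] q by (intro ennreal_leI) (simp add: q_def)
  also have "ennreal m' * (ennreal (m' ^ j * c) * ?W) = ennreal (m' ^ Suc j * c) * ?W"
    using m' by (simp add: ennreal_mult' mult.assoc)
  finally show ?case .
qed

lemma brw_cdf_bounded_away:
  assumes L: "AE x in M. - L \<le> x" "0 \<le> L" and p0: "pmf p 0 = 0"
    and p: "integrable (measure_pmf p) real" and m': "1 \<le> m'" "m' < measure_pmf.expectation p real"
    and walk: "ennreal ((1 / m') ^ l) \<le> walk_nn M l (indicator {u. real l * a' \<le> u}) 0"
    and l: "0 < l" and a: "a < a'"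
  obtains c k0 where "0 < c" "c < 1" "\<And>k y. k0 \<le> k \<Longrightarrow> y \<le> a * real k \<Longrightarrow> brw_cdf p M k y \<le> 1 - c"
proof -
  obtain u0 where u0: "0 < u0" "u0 \<le> 1"
    and h: "\<And>u. 0 \<le> u \<Longrightarrow> u \<le> 1 \<Longrightarrow> m' * min u u0 \<le> 1 - measure_pmf.expectation p (\<lambda>k. (1 - u) ^ k)"
    using pgf_complement_lower_bound[OF p m'(2)] m'(1) by (metis order_trans zero_le_one)
  \<comment> \<open>With this height the cap is met only at the end of a block of \<open>l\<close>
    generations, where the factor \<open>m' ^ l\<close> offsets the probability bound
    \<open>(1 / m') ^ l\<close> and the height \<open>c\<close> is restored.\<close>
  define c where "c = u0 / m' ^ l"
  have ml: "1 \<le> m' ^ l"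
    using m' by simp
  have c: "0 < c" "m' ^ l * c \<le> u0" "c \<le> 1"
    using u0 ml by (auto simp: c_def divide_le_eq)
  have block: "c \<le> 1 - brw_cdf p M (j * l) y" if "y < real j * (real l * a')" for j y
    using that
  proof (induction j arbitrary: y)
    case 0
    then show ?case
      using c by simp
  next
    case (Suc j)
    define s where "s = real j * (real l * a')"
    have "ennreal ((1 / m') ^ l) \<le> walk_nn M l (indicator {u. real l * a' \<le> u}) 0"
      by (rule walk)
    also have "\<dots> \<le> walk_nn M l (\<lambda>u. indicator {0<..} (u + (s - y))) 0"
      using Suc.prems by (intro walk_nn_mono) (auto simp: indicator_def s_def algebra_simps)
    also have "\<dots> = walk_nn M l (indicator {0<..}) (s - y)"
      by (simp add: walk_nn_shift)
    finally have "ennreal (m' ^ l * c) * ennreal ((1 / m') ^ l) \<le>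
        ennreal (m' ^ l * c) * walk_nn M l (indicator {0<..}) (s - y)"
      by (rule mult_left_mono) simp
    also have "\<dots> \<le> ennreal (1 - brw_cdf p M (j * l + l) y)"
      using Suc.IH by (intro brw_cdf_complement_ge_walk[OF h m'(1) c(1,2)]) (auto simp: s_def)
    also have "ennreal (m' ^ l * c) * ennreal ((1 / m') ^ l) = ennreal c"
      using m' c by (simp flip: ennreal_mult' add: power_one_over)
    finally have "c \<le> 1 - brw_cdf p M (j * l + l) y"
      by (subst (asm) ennreal_le_iff) (auto simp: brw_cdf_le_1)
    then show ?case
      by (simp add: add.commute)
  qed
  \<comment> \<open>After \<open>J\<close> blocks the slack \<open>a' - a\<close> outweighs what the
    remaining \<open>k mod l\<close> generations can lose, namely at most
    \<open>\<bar>a\<bar> + L\<close> each.\<close>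
  obtain J :: nat where J: "(\<bar>a\<bar> + L) / (a' - a) < real J"
    using reals_Archimedean2 by blast
  have "brw_cdf p M k y \<le> 1 - c" if k: "J * l + l \<le> k" and y: "y \<le> a * real k" for k y
  proof -
    define j r where "j = k div l" and "r = k mod l"
    have k_eq: "k = j * l + r" and r: "r < l"
      using l by (auto simp: j_def r_def)
    have "J \<le> j"
      using k l unfolding j_def by (metis add_leD1 div_le_mono nonzero_mult_div_cancel_right not_gr_zero)
    then have "(\<bar>a\<bar> + L) / (a' - a) < real j"
      using J by linarith
    then have "\<bar>a\<bar> + L < real j * (a' - a)"
      using a by (simp add: divide_less_eq)
    then have "real l * (\<bar>a\<bar> + L) < real l * (real j * (a' - a))"
      using l by (intro mult_strict_left_mono) auto
    moreover have "real r * (\<bar>a\<bar> + L) \<le> real l * (\<bar>a\<bar> + L)"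
      using r L by (intro mult_right_mono) auto
    moreover have "a * real r \<le> \<bar>a\<bar> * real r"
      by (intro mult_right_mono) auto
    ultimately have "y + real r * L < real j * (real l * a')"
      using y unfolding k_eq by (simp add: algebra_simps)
    then have "c \<le> 1 - brw_cdf p M (j * l) (y + real r * L)"
      by (rule block)
    \<comment> \<open>Used with exponent base 1: every vertex has at least one child, and following
      it lowers the position by at most \<open>L\<close> per generation.\<close>
    moreover have "brw_cdf p M k y \<le> brw_cdf p M (j * l) (y + real r * L) ^ (1 ^ r)"
      unfolding k_eq using p0 by (intro brw_cdf_add_le[OF L(1)]) auto
    ultimately show ?thesis
      by simp
  qed
  then have "brw_cdf p M k y \<le> 1 - min c (1 / 2)" if "J * l + l \<le> k" "y \<le> a * real k" for k y
    using that by (meson diff_left_mono min.cobounded1 order_trans)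
  moreover have "0 < min c (1 / 2)" "min c (1 / 2) < 1"
    using c by auto
  ultimately show ?thesis
    using that by blast
qed

text \<open>The first moment bound is \<open>\<rho> ^ k\<close> with \<open>\<rho> < 1\<close>,
  hence at most \<open>\<rho>\<close> for positive \<open>k\<close>; for \<open>k = 0\<close> the
  distribution function is evaluated at 0, where it equals 1.\<close>

lemma brw_cdf_bounded_below:
  assumes p: "integrable (measure_pmf p) real" and t: "0 \<le> t" "integrable M (\<lambda>x. exp (t * x))"
    and a: "measure_pmf.expectation p real * expectation (\<lambda>x. exp (t * x)) < exp (t * a)"
  obtains c where "0 < c" "\<And>k. c \<le> brw_cdf p M k (a * real k)"
proof -
  define \<rho> where "\<rho> = measure_pmf.expectation p real * expectation (\<lambda>x. exp (t * x)) * exp (- (t * a))"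
  have \<rho>: "0 \<le> \<rho>"
    by (auto simp: \<rho>_def intro!: mult_nonneg_nonneg integral_nonneg_AE)
  have "\<rho> < 1"
    using a by (simp add: \<rho>_def exp_minus field_simps)
  have "1 - \<rho> \<le> brw_cdf p M k (a * real k)" for k
  proof (cases "k = 0")
    case False
    have "1 - brw_cdf p M k (a * real k) \<le> (measure_pmf.expectation p real * expectation (\<lambda>x. exp (t * x))) ^ k *
        exp (- (t * (a * real k)))"
      by (rule brw_cdf_first_moment[OF p t])
    also have "exp (- (t * (a * real k))) = exp (- (t * a)) ^ k"
      unfolding exp_of_nat_mult[symmetric] by (simp add: algebra_simps)
    also have "(measure_pmf.expectation p real * expectation (\<lambda>x. exp (t * x))) ^ k * exp (- (t * a)) ^ k = \<rho> ^ k"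
      by (simp only: \<rho>_def power_mult_distrib)
    also have "\<dots> \<le> \<rho> ^ 1"
      using False \<rho> \<open>\<rho> < 1\<close> by (intro power_decreasing) auto
    finally show ?thesis
      by simp
  qed (use \<rho> in simp)
  then show ?thesis
    using that[of "1 - \<rho>"] \<open>\<rho> < 1\<close> by simp
qed

text \<open>Jensen's inequality in the form exp(u) \<ge> 1 + u. The resulting sign of log \<psi>
  drives the scaling argument in \<open>brw_cdf_below_speed\<close>.\<close>

lemma mgf_ge_1:
  assumes "integrable M (\<lambda>x. x)" "expectation (\<lambda>x. x) = 0"
  shows "1 \<le> mgf M t"
proof (cases "mgf M t" rule: ennreal_cases)
  case (real r)
  have int: "integrable M (\<lambda>x. exp (t * x))"
    using real by (intro integrableI_nonneg) (auto simp: mgf_def)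
  have "expectation (\<lambda>x. 1 + t * x) \<le> expectation (\<lambda>x. exp (t * x))"
    using assms int by (intro integral_mono) auto
  also have "expectation (\<lambda>x. 1 + t * x) = 1"
    using assms prob_space by simp
  finally have "ennreal 1 \<le> ennreal (expectation (\<lambda>x. exp (t * x)))"
    by (rule ennreal_leI)
  also have "\<dots> = mgf M t"
    unfolding mgf_def using int by (intro nn_integral_eq_integral[symmetric]) auto
  finally show ?thesis
    by simp
qed simp

text \<open>The multiplicative form removes extended-real logarithms: where \<psi> is infinite, both
  sides hold trivially.\<close>

lemma rate_function_le_iff:
  assumes "integrable M (\<lambda>x. x)" "expectation (\<lambda>x. x) = 0" "0 < m"
  shows "rate_function M z \<le> ereal (ln m) \<longleftrightarrow> (\<forall>t. ennreal (exp (t * z)) \<le> ennreal m * mgf M t)"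
proof -
  have "ereal (t * z) - ln_ennreal (mgf M t) \<le> ereal (ln m) \<longleftrightarrow> ennreal (exp (t * z)) \<le> ennreal m * mgf M t" for t
  proof (cases "mgf M t" rule: ennreal_cases)
    case (real r)
    have "ennreal 1 \<le> ennreal r"
      using mgf_ge_1[OF assms(1,2), of t] real by simp
    then have r: "1 \<le> r"
      using real(1) by (subst (asm) ennreal_le_iff) auto
    have "ereal (t * z) - ln_ennreal (mgf M t) \<le> ereal (ln m) \<longleftrightarrow> t * z - ln r \<le> ln m"
      using r by (simp add: ln_ennreal_def real)
    also have "\<dots> \<longleftrightarrow> t * z \<le> ln (m * r)"
      using r assms(3) by (simp add: ln_mult algebra_simps)
    also have "\<dots> \<longleftrightarrow> exp (t * z) \<le> m * r"
      using r assms(3) by (intro ln_ge_iff) auto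
    also have "\<dots> \<longleftrightarrow> ennreal (exp (t * z)) \<le> ennreal (m * r)"
      using r assms(3) by (intro ennreal_le_iff[symmetric]) auto
    also have "ennreal (m * r) = ennreal m * mgf M t"
      using r assms(3) by (simp add: real ennreal_mult)
    finally show ?thesis .
  next
    case top
    then show ?thesis
      using assms(3) by (simp add: ln_ennreal_def ennreal_mult_top)
  qed
  then show ?thesis
    by (simp add: rate_function_def SUP_le_iff)
qed

end

subsection \<open>The speed\<close>

lemma offspring_mean_eq_expectation:
  assumes "integrable (measure_pmf p) real"
  shows "offspring_mean p = measure_pmf.expectation p real"
  using sums_unique[OF sums_expectation_nat_pmf[OF assms]] by (simp add: offspring_mean_def mult.commute)

lemma integrable_offspring:
  assumes "0 < \<xi>" "summable (\<lambda>k. real k powr (1 + \<xi>) * pmf p k)"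
  shows "integrable (measure_pmf p) real"
proof -
  have "summable (\<lambda>k. norm (pmf p k * real k))"
  proof (rule summable_comparison_test'[OF assms(2)])
    fix k :: nat
    have "real k \<le> real k powr (1 + \<xi>)"
    proof (cases "k = 0")
      case False
      then have "real k powr 1 \<le> real k powr (1 + \<xi>)"
        using assms(1) by (intro powr_mono) auto
      then show ?thesis
        by simp
    qed simp
    then have "real k * pmf p k \<le> real k powr (1 + \<xi>) * pmf p k"
      by (intro mult_right_mono) auto
    then show "norm (norm (pmf p k * real k)) \<le> real k powr (1 + \<xi>) * pmf p k"
      by (simp add: mult.commute)
  qed
  then have "integrable (count_space UNIV) (\<lambda>k. pmf p k * real k)"
    by (simp add: integrable_count_space_nat_iff)
  then show ?thesis
    unfolding measure_pmf_eq_density by (subst integrable_density) auto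
qed

lemma pmf_min_offspring: "0 < pmf p (min_offspring p)"
proof -
  obtain k where "k \<in> set_pmf p"
    using set_pmf_not_empty[of p] by blast
  then have "0 < pmf p k"
    by (simp add: pmf_positive)
  then show ?thesis
    unfolding min_offspring_def by (rule LeastI)
qed

lemma pmf_less_min_offspring: "k < min_offspring p \<Longrightarrow> pmf p k = 0"
  using not_less_Least[of k "\<lambda>k. pmf p k > 0"] pmf_nonneg[of p k]
  by (auto simp: min_offspring_def)

text \<open>The form in which the asymptotic part uses the hypotheses: one positive point
  \<open>t0\<close> of finiteness stands for K, and the essential infimum is split into an almost
  sure bound and positive mass near it.\<close>

locale brw_law = real_distribution M for M :: "real measure" +
  fixes p :: "nat pmf" and b :: nat and L t0 :: real
  assumes integrable_p: "integrable (measure_pmf p) real"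
    and mean_gt_1: "1 < offspring_mean p"
    and integrable_id: "integrable M (\<lambda>x. x)"
    and mean_0: "expectation (\<lambda>x. x) = 0"
    and t0: "0 < t0" "mgf M t0 < \<infinity>"
    and b_ge_2: "2 \<le> b"
    and pmf_b: "0 < pmf p b"
    and pmf_less_b: "\<And>k. k < b \<Longrightarrow> pmf p k = 0"
    and L_pos: "0 < L"
    and AE_ge: "AE x in M. - L \<le> x"
    and mass_near: "\<And>l. l < L \<Longrightarrow> 0 < prob {x. x \<le> - l}"
begin

definition speed_set :: "real set" where
  "speed_set = {x. 0 \<le> x \<and> (\<forall>t. ennreal (exp (t * x)) \<le> ennreal (offspring_mean p) * mgf M t)}"

lemma speed_eq: "speed p M = Sup speed_set"
  unfolding speed_def speed_set_def
  using rate_function_le_iff[OF integrable_id mean_0] mean_gt_1 by simp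

lemma mgf_cases:
  obtains (infinite) "mgf M t = \<infinity>"
  | (finite) r where "1 \<le> r" "mgf M t = ennreal r" "integrable M (\<lambda>x. exp (t * x))"
      "expectation (\<lambda>x. exp (t * x)) = r"
proof (cases "mgf M t" rule: ennreal_cases)
  case (real r)
  have int: "integrable M (\<lambda>x. exp (t * x))"
    using real by (intro integrableI_nonneg) (auto simp: mgf_def)
  have "ennreal (expectation (\<lambda>x. exp (t * x))) = mgf M t"
    unfolding mgf_def using int by (intro nn_integral_eq_integral[symmetric]) auto
  then have "expectation (\<lambda>x. exp (t * x)) = r"
    using real by (subst (asm) real(2), subst (asm) ennreal_inj) auto
  moreover have "ennreal 1 \<le> ennreal r"
    using mgf_ge_1[OF integrable_id mean_0, of t] real by simp
  then have "1 \<le> r"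
    using real(1) by (subst (asm) ennreal_le_iff) auto
  ultimately show ?thesis
    using int real finite by blast
qed (use infinite in simp)

lemma exp_le_mgfD:
  assumes "ennreal (exp (t * x)) \<le> ennreal (offspring_mean p) * mgf M t" "mgf M t = ennreal r" "1 \<le> r"
  shows "exp (t * x) \<le> offspring_mean p * r"
proof -
  have "ennreal (exp (t * x)) \<le> ennreal (offspring_mean p * r)"
    using assms mean_gt_1 by (simp add: ennreal_mult)
  then show ?thesis
    using assms mean_gt_1 by (subst (asm) ennreal_le_iff) auto
qed

text \<open>The constraint at the single point \<open>t0\<close> already bounds the set, so that
  \<open>Sup\<close> is a true supremum.\<close>

lemma bdd_above_speed_set: "bdd_above speed_set"
proof -
  obtain r where r: "1 \<le> r" "mgf M t0 = ennreal r"
    using t0(2) by (cases rule: mgf_cases[of t0]) auto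
  show ?thesis
  proof (rule bdd_aboveI)
    fix x assume "x \<in> speed_set"
    then have "ennreal (exp (t0 * x)) \<le> ennreal (offspring_mean p) * mgf M t0"
      by (simp add: speed_set_def)
    then have "exp (t0 * x) \<le> offspring_mean p * r"
      using r(2,1) by (rule exp_le_mgfD)
    then have "t0 * x \<le> ln (offspring_mean p * r)"
      using r mean_gt_1 by (subst ln_ge_iff) auto
    then show "x \<le> ln (offspring_mean p * r) / t0"
      using t0(1) by (simp add: field_simps)
  qed
qed

text \<open>A centred variable without positive mass vanishes almost surely, but there is mass below
  \<open>- L / 2\<close>.\<close>

lemma prob_pos: "0 < prob {x. 0 < x}"
proof (rule ccontr)
  assume "\<not> 0 < prob {x. 0 < x}"
  then have "prob {x. 0 < x} = 0"
    using measure_nonneg[of M "{x. 0 < x}"] by linarith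
  then have "AE x in M. x \<notin> {x. 0 < x}"
    by (intro AE_not_in) (auto simp: null_sets_def emeasure_eq_measure)
  then have nonneg: "AE x in M. 0 \<le> - x"
    by eventually_elim auto
  moreover have "expectation (\<lambda>x. - x) = 0"
    using mean_0 by simp
  ultimately have "AE x in M. - x = 0"
    using integral_nonneg_eq_0_iff_AE[of M "\<lambda>x. - x"] integrable_id by simp
  then have "AE x in M. x \<notin> {x. x \<le> - (L / 2)}"
    by eventually_elim (use L_pos in auto)
  then have "prob {x. x \<le> - (L / 2)} = 0"
    by (subst prob_eq_0) auto
  then show False
    using mass_near[of "L / 2"] L_pos by simp
qed

text \<open>For \<open>t \<le> T\<close> the constraint follows from \<psi> \<ge> 1 and a small
  \<open>z\<close>; for larger \<open>t\<close> the mass at or above \<open>\<eta>\<close> makes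
  \<psi> grow faster than exp(tz).\<close>

lemma exists_pos_speed_set: "\<exists>z\<in>speed_set. 0 < z"
proof -
  let ?m = "offspring_mean p"
  obtain n where n: "0 < prob {x. 1 / real (Suc n) \<le> 1 * (x - 0) \<and> 1 * (x - 0) \<le> real n}"
    using exists_mass_away[of 1 0] prob_pos by auto
  define q where "q = prob {x. 1 / real (Suc n) \<le> 1 * (x - 0) \<and> 1 * (x - 0) \<le> real n}"
  define \<eta> where "\<eta> = 1 / real (Suc n)"
  have q: "0 < q" and \<eta>: "0 < \<eta>"
    using n by (auto simp: q_def \<eta>_def)
  have q_le: "ennreal (q * exp (t * \<eta>)) \<le> mgf M t" if "0 \<le> t" for t
  proof -
    have "q * exp (t * \<eta>) \<le> trunc_mgf 0 n t"
      using trunc_mgf_ge[of 1 n n t 0] that unfolding q_def \<eta>_def by simp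
    then have "ennreal (q * exp (t * \<eta>)) \<le> ennreal (trunc_mgf 0 n t)"
      by (rule ennreal_leI)
    also have "\<dots> \<le> (SUP R. ennreal (trunc_mgf 0 R t))"
      by (rule SUP_upper) simp
    also have "\<dots> = mgf M t"
      by (simp add: SUP_trunc_mgf mgf_def)
    finally show ?thesis .
  qed
  \<comment> \<open>From here on \<open>q * exp (t * \<eta> / 2) \<ge> 1\<close>, which leaves
    exp(t\<eta>/2) to dominate exp(tz).\<close>
  define T where "T = 2 * \<bar>ln q\<bar> / \<eta> + 1"
  have T: "0 < T"
    using \<eta> unfolding T_def by (intro add_nonneg_pos) auto
  define z where "z = min (\<eta> / 2) (ln ?m / T)"
  have z: "0 < z" "z \<le> \<eta> / 2" "z \<le> ln ?m / T"
    using \<eta> T mean_gt_1 unfolding z_def by (simp, intro min.cobounded1, intro min.cobounded2)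
  have "ennreal (exp (t * z)) \<le> ennreal ?m * mgf M t" for t
  proof (cases "t \<le> T")
    case True
    have "t * z \<le> T * z"
      using True z by (intro mult_right_mono) auto
    also have "\<dots> \<le> ln ?m"
      using z(3) T by (simp add: field_simps)
    finally have "exp (t * z) \<le> ?m"
      using mean_gt_1 by (subst (asm) ln_ge_iff) auto
    then have "ennreal (exp (t * z)) \<le> ennreal ?m * 1"
      by (simp add: ennreal_leI)
    also have "\<dots> \<le> ennreal ?m * mgf M t"
      by (intro mult_left_mono mgf_ge_1 integrable_id mean_0) auto
    finally show ?thesis .
  next
    case False
    then have t: "0 \<le> t" "T \<le> t"
      using T by auto
    have "2 * \<bar>ln q\<bar> / \<eta> \<le> t"
      using t by (simp add: T_def)
    then have "- ln q \<le> t * (\<eta> / 2)"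
      using \<eta> by (simp add: field_simps)
    moreover have "t * z \<le> t * (\<eta> / 2)"
      using t z by (intro mult_left_mono) auto
    moreover have "t * \<eta> = t * (\<eta> / 2) + t * (\<eta> / 2)"
      by simp
    ultimately have "t * z \<le> ln q + t * \<eta>"
      by linarith
    then have "exp (t * z) \<le> q * exp (t * \<eta>)"
      using q by (metis exp_add exp_le_cancel_iff exp_ln)
    then have "ennreal (exp (t * z)) \<le> ennreal (q * exp (t * \<eta>))"
      by (rule ennreal_leI)
    also have "\<dots> \<le> 1 * mgf M t"
      using q_le[OF t(1)] by simp
    also have "\<dots> \<le> ennreal ?m * mgf M t"
      using mean_gt_1 by (intro mult_right_mono) (auto simp flip: ennreal_1 intro: ennreal_leI)
    finally show ?thesis .
  qed
  then have "z \<in> speed_set"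
    using z(1) by (simp add: speed_set_def)
  then show ?thesis
    using z(1) by blast
qed

lemma speed_pos: "0 < speed p M"
  using exists_pos_speed_set cSup_upper[OF _ bdd_above_speed_set] unfolding speed_eq
  by (meson less_le_trans)

lemma mgf_shift: "(\<integral>\<^sup>+x. ennreal (exp (t * (x - a))) \<partial>M) = ennreal (exp (- (t * a))) * mgf M t"
proof -
  have "(\<integral>\<^sup>+x. ennreal (exp (t * (x - a))) \<partial>M) =
      (\<integral>\<^sup>+x. ennreal (exp (- (t * a))) * ennreal (exp (t * x)) \<partial>M)"
    by (intro nn_integral_cong) (simp add: ennreal_mult'[symmetric] exp_add[symmetric] algebra_simps)
  then show ?thesis
    by (simp add: nn_integral_cmult mgf_def)
qed

text \<open>A point \<open>z\<close> of the set beyond \<open>a'\<close> gives, after scaling by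
  \<open>\<theta> = a' / z\<close>, the strict bound I(a') \<le> \<theta> log m. Between this rate
  and log m there is room for \<open>m'\<close>, so Cramer's bound with
  \<open>\<gamma> = 1 / m'\<close> supplies the block length.\<close>

lemma brw_cdf_below_speed:
  assumes "0 \<le> a" "a < speed p M"
  obtains c k0 where "0 < c" "c < 1" "\<And>k y. k0 \<le> k \<Longrightarrow> y \<le> a * real k \<Longrightarrow> brw_cdf p M k y \<le> 1 - c"
proof -
  let ?m = "offspring_mean p"
  have lnm: "0 < ln ?m"
    using mean_gt_1 by simp
  define a' where "a' = (a + speed p M) / 2"
  have a': "a < a'" "a' < speed p M" "0 < a'"
    using assms by (auto simp: a'_def)
  obtain z where z: "z \<in> speed_set" "a' < z"
    using a'(2) exists_pos_speed_set unfolding speed_eq by (metis empty_iff less_cSupE)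
  have z_le: "ennreal (exp (t * z)) \<le> ennreal ?m * mgf M t" for t
    using z(1) by (simp add: speed_set_def)
  define \<theta> where "\<theta> = a' / z"
  have \<theta>: "0 < \<theta>" "\<theta> < 1" "\<theta> * z = a'"
    using a' z by (auto simp: \<theta>_def)
  define \<beta> where "\<beta> = exp (- (\<theta> * ln ?m))"
  have \<beta>: "ennreal \<beta> \<le> (\<integral>\<^sup>+x. ennreal (exp (t * (x - a'))) \<partial>M)" for t
  proof (cases rule: mgf_cases[of t])
    case infinite
    then show ?thesis
      by (simp add: mgf_shift ennreal_mult_top)
  next
    case (finite r)
    have "exp (t * z) \<le> ?m * r"
      using finite by (intro exp_le_mgfD z_le)
    then have "t * z \<le> ln (?m * r)"
      using finite mean_gt_1 by (subst ln_ge_iff) auto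
    also have "\<dots> = ln ?m + ln r"
      using finite mean_gt_1 by (simp add: ln_mult)
    finally have "\<theta> * (t * z) \<le> \<theta> * (ln ?m + ln r)"
      using \<theta> by (intro mult_left_mono) auto
    moreover have "\<theta> * (t * z) = t * a'"
      using \<theta> by (simp add: mult.left_commute)
    moreover have "\<theta> * ln r \<le> 1 * ln r"
      using \<theta> finite by (intro mult_right_mono) auto
    ultimately have "- (\<theta> * ln ?m) \<le> - (t * a') + ln r"
      by (simp add: ring_distribs)
    then have "\<beta> \<le> exp (- (t * a')) * r"
      unfolding \<beta>_def using finite(1) by (metis exp_add exp_le_cancel_iff exp_ln less_le_trans zero_less_one)
    then show ?thesis
      using finite(1,2) by (simp add: mgf_shift ennreal_mult'[symmetric] ennreal_leI)
  qed
  \<comment> \<open>Its logarithm is halfway between \<open>\<theta> * ln m\<close> and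
    \<open>ln m\<close>, which gives both \<open>1 / m' < \<beta>\<close> and
    \<open>m' < m\<close>.\<close>
  define m' where "m' = exp ((\<theta> + 1) / 2 * ln ?m)"
  have \<theta>_mid: "\<theta> < (\<theta> + 1) / 2" "(\<theta> + 1) / 2 < 1"
    using \<theta> by auto
  have "1 \<le> m'"
    using \<theta> lnm by (simp add: m'_def)
  have "(\<theta> + 1) / 2 * ln ?m < 1 * ln ?m"
    using \<theta>_mid lnm by (intro mult_strict_right_mono) auto
  then have "m' < exp (ln ?m)"
    unfolding m'_def by simp
  then have "m' < ?m"
    using mean_gt_1 by simp
  have "\<theta> * ln ?m < (\<theta> + 1) / 2 * ln ?m"
    using \<theta>_mid lnm by (intro mult_strict_right_mono) auto
  then have "1 / m' < \<beta>"
    unfolding m'_def \<beta>_def by (simp add: exp_minus inverse_eq_divide[symmetric] flip: exp_minus)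
  \<comment> \<open>If X never exceeded \<open>a'\<close>, then \<psi>(t) would be at most exp(ta')
    for \<open>t \<ge> 0\<close>, and the constraint at \<open>z > a'\<close> would fail for large
    \<open>t\<close>.\<close>
  have prob_gt: "0 < prob {x. a' < x}"
  proof (rule ccontr)
    assume "\<not> 0 < prob {x. a' < x}"
    then have "prob {x. a' < x} = 0"
      using measure_nonneg[of M "{x. a' < x}"] by linarith
    then have "AE x in M. x \<notin> {x. a' < x}"
      by (intro AE_not_in) (auto simp: null_sets_def emeasure_eq_measure)
    then have AE_le: "AE x in M. x \<le> a'"
      by eventually_elim auto
    define t where "t = (ln ?m + 1) / (z - a')"
    have t: "0 \<le> t"
      using lnm z by (simp add: t_def)
    have "mgf M t \<le> (\<integral>\<^sup>+x. ennreal (exp (t * a')) \<partial>M)"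
      unfolding mgf_def
    proof (rule nn_integral_mono_AE)
      show "AE x in M. ennreal (exp (t * x)) \<le> ennreal (exp (t * a'))"
        using AE_le by eventually_elim (use t in \<open>auto intro!: ennreal_leI mult_left_mono\<close>)
    qed
    also have "\<dots> = ennreal (exp (t * a'))"
      using emeasure_space_1 by simp
    finally have "ennreal ?m * mgf M t \<le> ennreal ?m * ennreal (exp (t * a'))"
      by (rule mult_left_mono) simp
    with z_le[of t] have "ennreal (exp (t * z)) \<le> ennreal (?m * exp (t * a'))"
      using mean_gt_1 by (simp add: ennreal_mult')
    then have "exp (t * z) \<le> ?m * exp (t * a')"
      using mean_gt_1 by (subst (asm) ennreal_le_iff) auto
    also have "\<dots> = exp (ln ?m + t * a')"
      using mean_gt_1 by (simp add: exp_add)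
    finally have "t * (z - a') \<le> ln ?m"
      by (simp add: right_diff_distrib)
    moreover have "t * (z - a') = ln ?m + 1"
      using z by (simp add: t_def)
    ultimately show False
      by simp
  qed
  have prob_lt: "0 < prob {x. x < a'}"
  proof -
    have "0 < prob {x. x \<le> - 0}"
      using L_pos by (intro mass_near)
    also have "\<dots> \<le> prob {x. x < a'}"
      using a' by (intro finite_measure_mono) auto
    finally show ?thesis .
  qed
  define \<delta> where "\<delta> = (a' - a) / 2"
  have \<delta>: "0 < \<delta>" "a < a' - \<delta>"
    using a' by (auto simp: \<delta>_def field_simps)
  have "eventually (\<lambda>n. ennreal ((1 / m') ^ n) \<le> walk_nn M n (indicator {u. real n * (a' - \<delta>) \<le> u}) 0) sequentially"
    using \<open>1 \<le> m'\<close> by (intro cramer_lower_bound[OF \<beta> _ \<open>1 / m' < \<beta>\<close> prob_gt prob_lt \<delta>(1)]) auto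
  then have "eventually (\<lambda>n. 0 < n \<and> ennreal ((1 / m') ^ n) \<le> walk_nn M n (indicator {u. real n * (a' - \<delta>) \<le> u}) 0) sequentially"
    using eventually_gt_at_top[of 0] by eventually_elim auto
  then obtain l where l: "0 < l" "ennreal ((1 / m') ^ l) \<le> walk_nn M l (indicator {u. real l * (a' - \<delta>) \<le> u}) 0"
    unfolding eventually_sequentially by blast
  show ?thesis
  proof (rule brw_cdf_bounded_away[OF AE_ge _ _ integrable_p \<open>1 \<le> m'\<close> _ l(2) l(1) \<delta>(2)])
    show "pmf p 0 = 0"
      using b_ge_2 by (intro pmf_less_b) auto
    show "m' < measure_pmf.expectation p real"
      using \<open>m' < ?m\<close> by (simp add: offspring_mean_eq_expectation integrable_p)
  qed (use L_pos that in auto)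
qed

text \<open>Outside the set some \<open>t\<close> violates the constraint. It is automatically
  positive, since exp(ta) > m\<psi>(t) > 1, as the first moment bound requires.\<close>

lemma brw_cdf_above_speed:
  assumes "speed p M < a"
  obtains c where "0 < c" "\<And>k. c \<le> brw_cdf p M k (a * real k)"
proof -
  let ?m = "offspring_mean p"
  have a: "0 < a"
    using assms speed_pos by linarith
  have "a \<notin> speed_set"
    using assms cSup_upper[OF _ bdd_above_speed_set, of a] by (auto simp: speed_eq)
  then obtain t where t: "\<not> ennreal (exp (t * a)) \<le> ennreal ?m * mgf M t"
    using a by (auto simp: speed_set_def)
  show ?thesis
  proof (cases rule: mgf_cases[of t])
    case infinite
    then show ?thesis
      using t mean_gt_1 by (simp add: ennreal_mult_top)
  next
    case (finite r)
    have lt: "?m * r < exp (t * a)"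
    proof (rule ccontr)
      assume "\<not> ?m * r < exp (t * a)"
      then have "ennreal (exp (t * a)) \<le> ennreal (?m * r)"
        by (intro ennreal_leI) simp
      then show False
        using t finite mean_gt_1 by (simp add: ennreal_mult)
    qed
    have "1 * 1 < ?m * r"
      using mean_gt_1 finite by (intro mult_less_le_imp_less) auto
    then have "0 < t * a"
      using lt by (metis exp_le_one_iff mult_1 not_less order_less_trans less_le_not_le)
    then have "0 \<le> t"
      using a by (simp add: zero_less_mult_iff)
    moreover have "measure_pmf.expectation p real * expectation (\<lambda>x. exp (t * x)) < exp (t * a)"
      using lt finite by (simp add: offspring_mean_eq_expectation integrable_p)
    ultimately show ?thesis
      using brw_cdf_bounded_below[OF integrable_p _ finite(3)] that by metis
  qed
qed

end

subsection \<open>Double logarithmic asymptotics\<close>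

text \<open>The terms \<plusminus>1 come from rounding \<alpha>n to an integer; together with the
  constants, which may depend on \<alpha>, they vanish after division by \<open>n\<close>.\<close>

lemma tendsto_linear_growth:
  fixes Y :: "nat \<Rightarrow> real" and \<Lambda> \<rho> :: real
  assumes "0 < \<Lambda>" "0 < \<rho>"
    and lower: "\<And>\<alpha>. 0 < \<alpha> \<Longrightarrow> \<alpha> < \<rho> \<Longrightarrow> \<exists>C. eventually (\<lambda>n. (\<alpha> * real n - 1) * \<Lambda> + C \<le> Y n) sequentially"
    and upper: "\<And>\<alpha>. \<rho> < \<alpha> \<Longrightarrow> \<exists>C. eventually (\<lambda>n. Y n \<le> (\<alpha> * real n + 1) * \<Lambda> + C) sequentially"
  shows "(\<lambda>n. 1 / real n * Y n) \<longlonglongrightarrow> \<rho> * \<Lambda>"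
proof -
  have lim: "(\<lambda>n. \<alpha> * \<Lambda> + C * (1 / real n)) \<longlonglongrightarrow> \<alpha> * \<Lambda>" for \<alpha> C
    using tendsto_add[OF tendsto_const tendsto_mult_right_zero[OF lim_1_over_n]] by simp
  show ?thesis
  proof (rule order_tendstoI)
    fix u assume u: "u < \<rho> * \<Lambda>"
    define v where "v = u / \<Lambda>"
    \<comment> \<open>The maximum with \<open>\<rho> / 2\<close> keeps \<alpha> positive when
      \<open>u\<close> is negative.\<close>
    define \<alpha> where "\<alpha> = max (\<rho> / 2) ((v + \<rho>) / 2)"
    have "v < \<rho>"
      using u assms(1) by (simp add: v_def divide_less_eq)
    then have \<alpha>: "0 < \<alpha>" "\<alpha> < \<rho>" "v < \<alpha>"
      using assms(2) by (auto simp: \<alpha>_def less_max_iff_disj)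
    have "u < \<alpha> * \<Lambda>"
      using \<alpha>(3) assms(1) by (simp add: v_def divide_less_eq)
    obtain C where C: "eventually (\<lambda>n. (\<alpha> * real n - 1) * \<Lambda> + C \<le> Y n) sequentially"
      using lower \<alpha> by blast
    have "eventually (\<lambda>n. u < \<alpha> * \<Lambda> + (C - \<Lambda>) * (1 / real n)) sequentially"
      using lim \<open>u < \<alpha> * \<Lambda>\<close> by (rule order_tendstoD)
    with C eventually_gt_at_top[of 0] show "eventually (\<lambda>n. u < 1 / real n * Y n) sequentially"
    proof eventually_elim
      case (elim n)
      have "\<alpha> * \<Lambda> + (C - \<Lambda>) * (1 / real n) = 1 / real n * ((\<alpha> * real n - 1) * \<Lambda> + C)"
        using elim by (simp add: field_simps)
      also have "\<dots> \<le> 1 / real n * Y n"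
        using elim by (intro mult_left_mono) auto
      finally show ?case
        using elim by linarith
    qed
  next
    fix u assume u: "\<rho> * \<Lambda> < u"
    define v where "v = u / \<Lambda>"
    define \<alpha> where "\<alpha> = (v + \<rho>) / 2"
    have "\<rho> < v"
      using u assms(1) by (simp add: v_def less_divide_eq)
    then have \<alpha>: "\<rho> < \<alpha>" "\<alpha> < v"
      by (auto simp: \<alpha>_def)
    have "\<alpha> * \<Lambda> < u"
      using \<alpha>(2) assms(1) by (simp add: v_def less_divide_eq)
    obtain C where C: "eventually (\<lambda>n. Y n \<le> (\<alpha> * real n + 1) * \<Lambda> + C) sequentially"
      using upper \<alpha> by blast
    have "eventually (\<lambda>n. \<alpha> * \<Lambda> + (C + \<Lambda>) * (1 / real n) < u) sequentially"
      using lim \<open>\<alpha> * \<Lambda> < u\<close> by (rule order_tendstoD)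
    with C eventually_gt_at_top[of 0] show "eventually (\<lambda>n. 1 / real n * Y n < u) sequentially"
    proof eventually_elim
      case (elim n)
      have "1 / real n * Y n \<le> 1 / real n * ((\<alpha> * real n + 1) * \<Lambda> + C)"
        using elim by (intro mult_left_mono) auto
      also have "\<dots> = \<alpha> * \<Lambda> + (C + \<Lambda>) * (1 / real n)"
        using elim by (simp add: field_simps)
      finally show ?case
        using elim by linarith
    qed
  qed
qed

context brw_law
begin

text \<open>Rounding \<alpha>n up is harmless: more generations are forced down and fewer are left
  to be typical, so the inequality between the slopes survives for every \<open>n\<close>.\<close>

lemma brw_cdf_double_exp_lower:
  assumes \<alpha>: "0 \<le> \<alpha>" "\<alpha> \<le> 1" and l: "0 \<le> l" "0 < prob {x. x \<le> - l}"
    and a: "speed p M < a" "a * (1 - \<alpha>) \<le> x + \<alpha> * l"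
  shows "\<exists>C>0. \<forall>n. exp (- C * real b ^ nat \<lceil>\<alpha> * real n\<rceil>) \<le> brw_cdf p M n (x * real n)"
proof -
  obtain c where c: "0 < c" "\<And>k. c \<le> brw_cdf p M k (a * real k)"
    using brw_cdf_above_speed[OF a(1)] by metis
  have "0 < a"
    using a(1) speed_pos by linarith
  define \<kappa> where "\<kappa> = pmf p b * prob {x. x \<le> - l} ^ b"
  have \<kappa>: "0 < \<kappa>" "\<kappa> \<le> 1"
    using pmf_b l(2) by (auto simp: \<kappa>_def mult_le_one power_le_one pmf_le_1)
  have "c \<le> 1"
    using c(2)[of 0] by simp
  \<comment> \<open>Halving keeps the base strictly below 1, so that the constant in the exponent is
    positive.\<close>
  then have d: "0 < \<kappa> * c / 2" "\<kappa> * c / 2 < 1"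
    using \<kappa> c(1) mult_le_one[of \<kappa> c] by auto
  have "exp (- (- ln (\<kappa> * c / 2)) * real b ^ nat \<lceil>\<alpha> * real n\<rceil>) \<le> brw_cdf p M n (x * real n)" for n
  proof -
    define j where "j = nat \<lceil>\<alpha> * real n\<rceil>"
    have j_ge: "\<alpha> * real n \<le> real j"
      unfolding j_def by linarith
    have "\<alpha> * real n \<le> 1 * real n"
      using \<alpha> by (intro mult_right_mono) auto
    then have "j \<le> n"
      unfolding j_def by (simp add: ceiling_le_iff nat_le_iff)
    define k where "k = n - j"
    have n: "n = k + j"
      using \<open>j \<le> n\<close> by (simp add: k_def)
    have "a * real k \<le> x * real n + real j * l"
    proof -
      have "a * real k = a * real n - a * real j"
        by (simp add: n algebra_simps)
      also have "\<dots> \<le> a * real n - a * (\<alpha> * real n)"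
        using j_ge \<open>0 < a\<close> by simp
      also have "\<dots> = a * (1 - \<alpha>) * real n"
        by (simp add: algebra_simps)
      also have "\<dots> \<le> (x + \<alpha> * l) * real n"
        using a(2) by (intro mult_right_mono) auto
      also have "\<dots> = x * real n + (\<alpha> * real n) * l"
        by (simp add: algebra_simps)
      also have "\<dots> \<le> x * real n + real j * l"
        using j_ge l(1) by (intro add_left_mono mult_right_mono) auto
      finally show ?thesis .
    qed
    then have F_ge: "c \<le> brw_cdf p M k (x * real n + real j * l)"
      using c(2)[of k] brw_cdf_mono order_trans by blast
    have "exp (- (- ln (\<kappa> * c / 2)) * real b ^ j) = (\<kappa> * c / 2) ^ (b ^ j)"
      using d(1) by (simp add: mult.commute[of "ln _"] exp_of_nat_mult flip: of_nat_power)
    also have "\<dots> \<le> (\<kappa> * brw_cdf p M k (x * real n + real j * l)) ^ (b ^ j)"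
    proof (intro power_mono)
      have "\<kappa> * c / 2 \<le> \<kappa> * c"
        using d by simp
      also have "\<dots> \<le> \<kappa> * brw_cdf p M k (x * real n + real j * l)"
        using F_ge \<kappa> by (intro mult_left_mono) auto
      finally show "\<kappa> * c / 2 \<le> \<kappa> * brw_cdf p M k (x * real n + real j * l)" .
    qed (use d in auto)
    also have "\<dots> \<le> \<kappa> * brw_cdf p M n (x * real n)"
      unfolding \<kappa>_def n using b_ge_2 by (rule brw_cdf_add_ge)
    also have "\<dots> \<le> 1 * brw_cdf p M n (x * real n)"
      using \<kappa> by (intro mult_right_mono brw_cdf_nonneg)
    finally show ?thesis
      by (simp add: j_def)
  qed
  moreover have "0 < - ln (\<kappa> * c / 2)"
    using d by simp
  ultimately show ?thesis
    by blast
qed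

text \<open>Two slopes occur because the forced proportion is capped at 1, while the limit argument
  asks for a bound with the uncapped one.\<close>

lemma log_log_brw_cdf_upper:
  assumes C: "0 < C" "\<And>n. exp (- C * real b ^ nat \<lceil>\<alpha> * real n\<rceil>) \<le> brw_cdf p M n (x * real n)"
    and \<alpha>: "0 \<le> \<alpha>" "\<alpha> \<le> \<alpha>'"
  shows "ln (- ln (brw_cdf p M n (x * real n))) \<le> (\<alpha>' * real n + 1) * ln (real b) + max 0 (ln C)"
proof -
  define F where "F = brw_cdf p M n (x * real n)"
  define j where "j = nat \<lceil>\<alpha> * real n\<rceil>"
  have lnb: "0 < ln (real b)"
    using b_ge_2 by simp
  have nonneg: "0 \<le> \<alpha>' * real n + 1"
    using \<alpha> by (intro add_nonneg_nonneg mult_nonneg_nonneg) auto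
  have F: "exp (- C * real b ^ j) \<le> F"
    using C(2)[of n] by (simp add: F_def j_def)
  then have "0 < F"
    using exp_gt_zero less_le_trans by blast
  then have "- C * real b ^ j \<le> ln F"
    using F by (subst ln_ge_iff) auto
  then have le: "- ln F \<le> C * real b ^ j"
    by simp
  have "ln F \<le> 0"
    using \<open>0 < F\<close> brw_cdf_le_1 by (simp add: F_def)
  show ?thesis
  \<comment> \<open>For \<open>F = 1\<close> the left-hand side is \<open>ln 0 = 0\<close>;
    \<open>max 0 (ln C)\<close> keeps the bound nonnegative there.\<close>
  proof (cases "ln F = 0")
    case True
    then show ?thesis
      using lnb nonneg by (simp add: F_def)
  next
    case False
    then have "ln (- ln F) \<le> ln (C * real b ^ j)"
      using le \<open>ln F \<le> 0\<close> C(1) b_ge_2 by (subst ln_le_cancel_iff) auto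
    also have "\<dots> = real j * ln (real b) + ln C"
      using C(1) b_ge_2 by (simp add: ln_mult ln_realpow)
    also have "\<dots> \<le> (\<alpha>' * real n + 1) * ln (real b) + max 0 (ln C)"
    proof (intro add_mono mult_right_mono)
      have "0 \<le> \<alpha> * real n"
        using \<alpha> by simp
      then have "real j \<le> \<alpha> * real n + 1"
        unfolding j_def by linarith
      also have "\<dots> \<le> \<alpha>' * real n + 1"
        using \<alpha> by (intro add_right_mono mult_right_mono) auto
      finally show "real j \<le> \<alpha>' * real n + 1" .
    qed (use lnb in auto)
    finally show ?thesis
      by (simp add: F_def)
  qed
qed

text \<open>Rounding \<alpha>n down leaves at least (1 - \<alpha>)n typical generations, which
  exceeds \<open>k0\<close> eventually. Positivity is what makes \<open>ln\<close> monotone at the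
  value in question.\<close>

lemma log_log_brw_cdf_lower:
  assumes \<alpha>: "0 < \<alpha>" "\<alpha> < 1" and a: "0 \<le> a" "a < speed p M" "x + \<alpha> * L \<le> a * (1 - \<alpha>)"
    and pos: "\<And>n. 0 < brw_cdf p M n (x * real n)"
  shows "\<exists>C. eventually (\<lambda>n. (\<alpha> * real n - 1) * ln (real b) + C \<le> ln (- ln (brw_cdf p M n (x * real n)))) sequentially"
proof -
  obtain c k0 where c: "0 < c" "c < 1"
    and F_le: "\<And>k y. k0 \<le> k \<Longrightarrow> y \<le> a * real k \<Longrightarrow> brw_cdf p M k y \<le> 1 - c"
    using brw_cdf_below_speed[OF a(1,2)] by metis
  define C where "C = - ln (1 - c)"
  have C: "0 < C"
    using c by (simp add: C_def)
  have "eventually (\<lambda>n. real k0 / (1 - \<alpha>) \<le> real n) sequentially"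
    using filterlim_real_sequentially by (auto simp: filterlim_at_top)
  then have "eventually (\<lambda>n. (\<alpha> * real n - 1) * ln (real b) + ln C \<le> ln (- ln (brw_cdf p M n (x * real n)))) sequentially"
  proof eventually_elim
    case (elim n)
    define F where "F = brw_cdf p M n (x * real n)"
    define j where "j = nat \<lfloor>\<alpha> * real n\<rfloor>"
    have "0 \<le> \<alpha> * real n"
      using \<alpha> by simp
    then have j: "real j \<le> \<alpha> * real n" "\<alpha> * real n - 1 \<le> real j"
      unfolding j_def by linarith+
    have "\<alpha> * real n \<le> 1 * real n"
      using \<alpha> by (intro mult_right_mono) auto
    then have "j \<le> n"
      using j(1) by linarith
    define k where "k = n - j"
    have n: "n = k + j"
      using \<open>j \<le> n\<close> by (simp add: k_def)
    have k_ge: "(1 - \<alpha>) * real n \<le> real k"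
      using j(1) by (simp add: n algebra_simps)
    have "real k0 \<le> (1 - \<alpha>) * real n"
      using elim \<alpha> by (simp add: divide_le_eq mult.commute)
    then have "k0 \<le> k"
      using k_ge by linarith
    moreover have "x * real n + real j * L \<le> a * real k"
    proof -
      have "x * real n + real j * L \<le> x * real n + (\<alpha> * real n) * L"
        using j(1) L_pos by (intro add_left_mono mult_right_mono) auto
      also have "\<dots> = (x + \<alpha> * L) * real n"
        by (simp add: algebra_simps)
      also have "\<dots> \<le> a * (1 - \<alpha>) * real n"
        using a(3) by (intro mult_right_mono) auto
      also have "\<dots> \<le> a * real k"
        using k_ge a(1) by (simp add: mult.assoc mult_left_mono)
      finally show ?thesis .
    qed
    ultimately have Fk: "brw_cdf p M k (x * real n + real j * L) \<le> 1 - c"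
      by (rule F_le)
    have "F \<le> brw_cdf p M k (x * real n + real j * L) ^ (b ^ j)"
      unfolding F_def n by (rule brw_cdf_add_le[OF AE_ge pmf_less_b])
    also have "\<dots> \<le> (1 - c) ^ (b ^ j)"
      by (intro power_mono Fk brw_cdf_nonneg)
    finally have "ln F \<le> ln ((1 - c) ^ (b ^ j))"
      using pos[of n] c by (subst ln_le_cancel_iff) (auto simp: F_def)
    also have "\<dots> = - (C * real b ^ j)"
      using c by (simp add: ln_realpow C_def)
    finally have le: "C * real b ^ j \<le> - ln F"
      by simp
    have bj: "0 < real b ^ j"
      using b_ge_2 by simp
    have "(\<alpha> * real n - 1) * ln (real b) + ln C \<le> real j * ln (real b) + ln C"
      using j(2) b_ge_2 by (intro add_right_mono mult_right_mono) auto
    also have "\<dots> = ln (C * real b ^ j)"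
      using C b_ge_2 by (simp add: ln_mult ln_realpow)
    also have "\<dots> \<le> ln (- ln F)"
      using le mult_pos_pos[OF C bj] by (intro ln_mono) linarith+
    finally show ?case
      by (simp add: F_def)
  qed
  then show ?thesis
    by blast
qed

text \<open>\<open>\<rho>\<close> solves \<open>x + \<rho> * L = speed p M * (1 - \<rho>)\<close>.
  It is below 1 for \<open>x > - L\<close>, which leaves room to replace \<open>L\<close> by a
  smaller \<open>l\<close>; at \<open>x = - L\<close> it equals 1 and all \<open>n\<close>
  generations step by \<open>- L\<close>, hence the condition on the mass there.\<close>

lemma tendsto_log_log_brw_cdf:
  assumes x: "x < speed p M" and "- L < x \<or> x = - L \<and> 0 < prob {x. x \<le> - L}"
  shows "(\<lambda>n. 1 / real n * ln (- ln (brw_cdf p M n (x * real n))))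
    \<longlonglongrightarrow> (speed p M - x) / (speed p M + L) * ln (real b)"
proof -
  define \<rho> where "\<rho> = (speed p M - x) / (speed p M + L)"
  have sL: "0 < speed p M + L"
    using speed_pos L_pos by simp
  have \<rho>: "0 < \<rho>" "\<rho> \<le> 1" "\<rho> * (speed p M + L) = speed p M - x"
    using x assms(2) sL by (auto simp: \<rho>_def)
  have double_exp: "\<exists>C>0. \<forall>n. exp (- C * real b ^ nat \<lceil>min \<alpha> 1 * real n\<rceil>) \<le> brw_cdf p M n (x * real n)"
    if "\<rho> < \<alpha>" for \<alpha>
  proof -
    have \<alpha>: "0 \<le> min \<alpha> 1" "min \<alpha> 1 \<le> 1"
      using that \<rho> by auto
    from assms(2) show ?thesis
    proof
      assume "- L < x"
      then have "\<rho> < 1"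
        using sL by (simp add: \<rho>_def divide_less_eq)
      then have "\<rho> * (speed p M + L) < min \<alpha> 1 * (speed p M + L)"
        using that sL by (intro mult_strict_right_mono) auto
      \<comment> \<open>The slack in the slope inequality; half of it raises the speed and half pays
        for lowering \<open>L\<close> by \<open>\<epsilon>\<close>.\<close>
      define D where "D = x + min \<alpha> 1 * L - speed p M * (1 - min \<alpha> 1)"
      have D: "0 < D"
        using \<open>\<rho> * (speed p M + L) < _\<close> \<rho>(3) unfolding D_def by (simp add: algebra_simps)
      define \<epsilon> where "\<epsilon> = min (D / 2) (L / 2)"
      have \<epsilon>: "0 < \<epsilon>" "\<epsilon> \<le> D / 2" "\<epsilon> \<le> L / 2"
        using D L_pos unfolding \<epsilon>_def by (simp, intro min.cobounded1, intro min.cobounded2)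
      show ?thesis
      proof (rule brw_cdf_double_exp_lower[OF \<alpha>])
        show "0 \<le> L - \<epsilon>"
          using \<epsilon> L_pos by linarith
        show "0 < prob {x. x \<le> - (L - \<epsilon>)}"
          using \<epsilon> by (intro mass_near) simp
        show "speed p M < speed p M + D / 2"
          using D by simp
        have "min \<alpha> 1 * \<epsilon> \<le> min \<alpha> 1 * (D / 2)"
          using \<alpha> \<epsilon> by (intro mult_left_mono) auto
        moreover have "speed p M * (1 - min \<alpha> 1) + D = x + min \<alpha> 1 * L"
          by (simp add: D_def)
        moreover have "(speed p M + D / 2) * (1 - min \<alpha> 1) =
            speed p M * (1 - min \<alpha> 1) + D / 2 - min \<alpha> 1 * (D / 2)"
          by (simp add: field_simps)
        moreover have "x + min \<alpha> 1 * (L - \<epsilon>) = x + min \<alpha> 1 * L - min \<alpha> 1 * \<epsilon>"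
          by (simp add: algebra_simps)
        ultimately show "(speed p M + D / 2) * (1 - min \<alpha> 1) \<le> x + min \<alpha> 1 * (L - \<epsilon>)"
          using D by linarith
      qed
    next
      assume xL: "x = - L \<and> 0 < prob {x. x \<le> - L}"
      then have "\<rho> = 1"
        using sL by (simp add: \<rho>_def)
      then have "min \<alpha> 1 = 1"
        using that by simp
      then show ?thesis
        \<comment> \<open>No typical generations remain: the factor \<open>1 - \<alpha>\<close>
          vanishes, so any slope above the speed serves.\<close>
        using xL L_pos by (intro brw_cdf_double_exp_lower[of _ L "speed p M + 1"]) auto
    qed
  qed
  have pos: "0 < brw_cdf p M n (x * real n)" for n
  proof -
    obtain C where "exp (- C * real b ^ nat \<lceil>min (\<rho> + 1) 1 * real n\<rceil>) \<le> brw_cdf p M n (x * real n)"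
      using double_exp[of "\<rho> + 1"] by auto
    then show ?thesis
      using exp_gt_zero less_le_trans by blast
  qed
  have "(\<lambda>n. 1 / real n * ln (- ln (brw_cdf p M n (x * real n)))) \<longlonglongrightarrow> \<rho> * ln (real b)"
  proof (rule tendsto_linear_growth)
    show "0 < ln (real b)"
      using b_ge_2 by simp
    show "0 < \<rho>"
      by (rule \<rho>)
  next
    fix \<alpha> assume \<alpha>: "0 < \<alpha>" "\<alpha> < \<rho>"
    then have "\<alpha> < 1"
      using \<rho> by linarith
    have "\<alpha> * (speed p M + L) < \<rho> * (speed p M + L)"
      using \<alpha> sL by (intro mult_strict_right_mono) auto
    then have "x + \<alpha> * L < speed p M * (1 - \<alpha>)"
      using \<rho>(3) by (simp add: algebra_simps)
    then have lt: "(x + \<alpha> * L) / (1 - \<alpha>) < speed p M"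
      using \<open>\<alpha> < 1\<close> by (simp add: divide_less_eq)
    \<comment> \<open>\<open>x + \<alpha> * L\<close> may be negative, while
      \<open>brw_cdf_below_speed\<close> needs a nonnegative slope; 0 is admissible since the speed
      is positive.\<close>
    define a where "a = max 0 ((x + \<alpha> * L) / (1 - \<alpha>))"
    have "(x + \<alpha> * L) / (1 - \<alpha>) * (1 - \<alpha>) \<le> a * (1 - \<alpha>)"
      using \<open>\<alpha> < 1\<close> by (intro mult_right_mono) (auto simp: a_def)
    then have "x + \<alpha> * L \<le> a * (1 - \<alpha>)"
      using \<open>\<alpha> < 1\<close> by simp
    moreover have "0 \<le> a" "a < speed p M"
      using lt speed_pos by (auto simp: a_def)
    ultimately show "\<exists>C. eventually (\<lambda>n. (\<alpha> * real n - 1) * ln (real b) + C \<le>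
        ln (- ln (brw_cdf p M n (x * real n)))) sequentially"
      using \<alpha>(1) \<open>\<alpha> < 1\<close> pos by (intro log_log_brw_cdf_lower)
  next
    fix \<alpha> assume \<alpha>: "\<rho> < \<alpha>"
    then obtain C where C: "0 < C" "\<And>n. exp (- C * real b ^ nat \<lceil>min \<alpha> 1 * real n\<rceil>) \<le> brw_cdf p M n (x * real n)"
      using double_exp by blast
    have "ln (- ln (brw_cdf p M n (x * real n))) \<le> (\<alpha> * real n + 1) * ln (real b) + max 0 (ln C)" for n
      using \<alpha> \<rho> by (intro log_log_brw_cdf_upper[OF C]) auto
    then show "\<exists>C. eventually (\<lambda>n. ln (- ln (brw_cdf p M n (x * real n))) \<le>
        (\<alpha> * real n + 1) * ln (real b) + C) sequentially"
      by (intro exI always_eventually allI)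
  qed
  then show ?thesis
    by (simp add: \<rho>_def)
qed

end

lemma essinf_eq_imp:
  assumes "prob_space \<mu>" "sets \<mu> = sets borel" "essinf \<mu> (\<lambda>x. x) = ereal (- L)"
  shows "AE x in \<mu>. - L \<le> x" and "l < L \<Longrightarrow> 0 < measure \<mu> {x. x \<le> - l}"
proof -
  interpret prob_space \<mu> by fact
  have meas: "(\<lambda>x. - ereal x) \<in> borel_measurable \<mu>"
    using assms(2) by (simp cong: measurable_cong_sets)
  have sup: "esssup \<mu> (\<lambda>x. - ereal x) = ereal L"
    using assms(3) by (simp add: essinf_def ereal_uminus_eq_reorder)
  show "AE x in \<mu>. - L \<le> x"
    using esssup_AE[where M = \<mu> and f = "\<lambda>x. - ereal x"] unfolding sup by eventually_elim simp
  assume "l < L"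
  then have "0 < emeasure \<mu> {x \<in> space \<mu>. ereal l < - ereal x}"
    using meas by (intro esssup_pos_measure) (simp_all only: sup less_ereal.simps)
  also have "\<dots> \<le> emeasure \<mu> {x. x \<le> - l}"
    using assms(2) by (intro emeasure_mono) auto
  finally show "0 < measure \<mu> {x. x \<le> - l}"
    by (simp add: emeasure_eq_measure)
qed

theorem theorem1p1:
  fixes M :: "'w measure" and p :: "nat pmf" and step :: "real measure"
    and N :: "nat list \<Rightarrow> 'w \<Rightarrow> nat" and X :: "nat list \<Rightarrow> 'w \<Rightarrow> real"
    and \<xi> L :: real and K :: ereal
  defines "m \<equiv> offspring_mean p" and "b \<equiv> min_offspring p" and "xstar \<equiv> speed p step"
    and "P \<equiv> \<lambda>(x::real) (n::nat). measure M {\<omega> \<in> space M.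
           brw_max (\<lambda>v. N v \<omega>) (\<lambda>v. X v \<omega>) n \<le> ereal (x * real n)}"
  assumes "branching_random_walk M p step N X"
    and "m > 1"
    and "\<xi> > 0" and "summable (\<lambda>k. real k powr (1 + \<xi>) * pmf p k)"
    and "integrable step (\<lambda>x. x)" and "(\<integral>x. x \<partial>step) = 0"
    and "K > 0" and "\<And>t::real. - K < ereal t \<Longrightarrow> ereal t < K \<Longrightarrow> mgf step t < \<infinity>"
    and "b \<ge> 2"
    and "L > 0" and "essinf step (\<lambda>x. x) = ereal (- L)"
  shows "(\<forall>x. - L < x \<and> x < xstar \<longrightarrow>
            (\<lambda>n. 1 / real n * ln (- ln (P x n)))
              \<longlonglongrightarrow> (xstar - x) / (xstar + L) * ln (real b))
       \<and> (measure step {- L} > 0 \<longrightarrow>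
            (\<lambda>n. 1 / real n * ln (- ln (P (- L) n)))
              \<longlonglongrightarrow> (xstar - (- L)) / (xstar + L) * ln (real b))"
proof -
  interpret brw: branching_random_walk M p step N X
    by fact
  interpret step: real_distribution step
    by (rule brw.real_distribution_step)
  obtain t0 where t0: "0 < ereal t0" "ereal t0 < K"
    using ereal_dense2[OF \<open>K > 0\<close>] by blast
  have "- K < 0"
    using \<open>K > 0\<close> by (simp add: ereal_uminus_less_reorder)
  then have "- K < ereal t0"
    using t0(1) by (rule less_trans)
  then have "mgf step t0 < \<infinity>"
    using t0(2) by (rule assms(12))
  interpret brw_law step p b L t0
  proof
    show "integrable (measure_pmf p) real"
      using assms(7,8) by (rule integrable_offspring)
    show "1 < offspring_mean p"
      using assms(6) by (simp add: m_def)
    show "integrable step (\<lambda>x. x)" "step.expectation (\<lambda>x. x) = 0" "2 \<le> b" "0 < L" "mgf step t0 < \<infinity>"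
      by fact+
    show "0 < t0"
      using t0(1) by simp
    show "0 < pmf p b" "\<And>k. k < b \<Longrightarrow> pmf p k = 0"
      by (auto simp: b_def pmf_min_offspring pmf_less_min_offspring)
    show "AE x in step. - L \<le> x" "\<And>l. l < L \<Longrightarrow> 0 < step.prob {x. x \<le> - l}"
      using essinf_eq_imp[OF step.prob_space_axioms _ assms(15)] by auto
  qed
  have P_eq: "P x n = brw_cdf p step n (x * real n)" for x n
    unfolding P_def by (rule brw.prob_brw_max_le)
  have "0 < step.prob {x. x \<le> - L}" if "0 < measure step {- L}"
    using that step.finite_measure_mono[of "{- L}" "{x. x \<le> - L}"] by auto
  moreover have "- L < xstar"
    using speed_pos L_pos by (simp add: xstar_def)
  ultimately show ?thesis
    unfolding P_eq xstar_def by (intro conjI allI impI tendsto_log_log_brw_cdf) blast+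
qed

end
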